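(* Let $L>0$, let $T\ge1$ be an integer, and let $d\ge 8(T+1)^2+T$ be an integer. For every deterministic method that makes $T$ queries $X_1,\dots,X_T\in\operatorname{ri}(\boldsymbol{\Delta}_d)$ of the oracle $X\mapsto(F(X),\nabla F(X))$ and returns $X_{T+1}\in\boldsymbol{\Delta}_d$, there exists $F\in\mathsf{Ent}_d^{\mathsf H}(L)$ such that, when the method is run on $F$, $$F(X_{T+1})-\min_{X\in\boldsymbol{\Delta}_d}F(X)>\frac{L}{4(T+1)} .$$
   Context: $\mathbf{H}^d$ is the real vector space of Hermitian $d\times d$ matrices with inner product $\langle U,V\rangle=\operatorname{tr}(UV)$, $\mathbf{H}^d_+$ its positive-semidefinite cone, and $\boldsymbol{\Delta}_d:=\{X\in\mathbf{H}^d_+:\operatorname{tr}(X)=1\}$. Its relative interior $\operatorname{ri}(\boldsymbol{\Delta}_d)$ consists of the positive-definite unit-trace Hermitian matrices. For $X\in\boldsymbol{\Delta}_d$, $U\in\operatorname{ri}(\boldsymbol{\Delta}_d)$, the quantum relative entropy is $D_{h\circ\lambda}(X,U):=\operatorname{tr}(X(\log X-\log U))$ (with the convention $0\log0=0$ for $X\log X$). For $F:\boldsymbol{\Delta}_d\to\mathbb{R}$ differentiable on $\operatorname{ri}(\boldsymbol{\Delta}_d)$ (within the affine hull of $\boldsymbol{\Delta}_d$), $\nabla F(U)\in\operatorname{span}\{I_d\}^\perp$ denotes the tangent gradient: the unique traceless Hermitian matrix representing the differential of $F$ along traceless Hermitian directions. The class $\mathsf{Ent}_d^{\mathsf H}(L)$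 consists of all convex functions $F:\boldsymbol{\Delta}_d\to\mathbb{R}$ that are continuously differentiable on $\operatorname{ri}(\boldsymbol{\Delta}_d)$ and satisfy, for all $(X,U)\in\boldsymbol{\Delta}_d\times\operatorname{ri}(\boldsymbol{\Delta}_d)$, $$0\le F(X)-F(U)-\langle\nabla F(U),X-U\rangle\le L\,D_{h\circ\lambda}(X,U).$$ A deterministic method with $T$ queries is a collection of arbitrary maps $\boldsymbol{\Phi}_t:\boldsymbol{\Omega}^{t-1}\to\operatorname{ri}(\boldsymbol{\Delta}_d)$ ($1\le t\le T$) and $\bar{\boldsymbol{\Phi}}_{T+1}:\boldsymbol{\Omega}^T\to\boldsymbol{\Delta}_d$, where $\boldsymbol{\Omega}=\mathbb{R}\times\operatorname{span}\{I_d\}^\perp$ and $\boldsymbol{\Omega}^0$ is a singleton. Run on $F$, it queries $X_1=\boldsymbol{\Phi}_1$, then $X_t=\boldsymbol{\Phi}_t$ applied to the previous answers $(F(X_s),\nabla F(X_s))_{s<t}$ for $2\le t\le T$, and returns $X_{T+1}=\bar{\boldsymbol{\Phi}}_{T+1}$ applied to all answers $(F(X_s),\nabla F(X_s))_{s\le T}$. *)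

theory Defs
  imports "HOL-Analysis.Analysis"
begin

text \<open>The dimension \<open>d\<close> is \<open>CARD('n)\<close>. Hermitian matrices are a real subspace of
  \<open>complex^'n^'n\<close>.\<close>

definition adj_mat :: "complex^'n^'n \<Rightarrow> complex^'n^'n" where
  "adj_mat A = (\<chi> i j. cnj (A $ j $ i))"

definition hermitian_mat :: "complex^'n^'n \<Rightarrow> bool" where
  "hermitian_mat A \<longleftrightarrow> adj_mat A = A"

definition unitary_mat :: "complex^'n^'n \<Rightarrow> bool" where
  "unitary_mat V \<longleftrightarrow> adj_mat V ** V = mat 1 \<and> V ** adj_mat V = mat 1"

text \<open>The trace of a product of two Hermitian matrices is real, so taking \<open>Re\<close> loses nothing.\<close>

definition herm_inner :: "complex^'n^'n \<Rightarrow> complex^'n^'n \<Rightarrow> real" where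
  "herm_inner U V = Re (trace (U ** V))"

definition psd_mat :: "complex^'n^'n \<Rightarrow> bool" where
  "psd_mat A \<longleftrightarrow> hermitian_mat A \<and>
     (\<forall>x :: complex^'n. 0 \<le> Re (\<Sum>i\<in>UNIV. cnj (x $ i) * (A *v x) $ i))"

definition Spectraplex :: "(complex^'n^'n) set" where
  "Spectraplex = {X. psd_mat X \<and> trace X = 1}"

definition traceless_herm :: "(complex^'n^'n) set" where
  "traceless_herm = {G. hermitian_mat G \<and> trace G = 0}"

definition diag_mat :: "('n \<Rightarrow> real) \<Rightarrow> complex^'n^'n" where
  "diag_mat l = (\<chi> i j. if i = j then complex_of_real (l i) else 0)"

text \<open>Spectral functional calculus for Hermitian matrices. The result does not depend on the chosen
  unitary diagonalisation; see \<open>herm_fun_eq\<close> below.\<close>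

definition herm_fun :: "(real \<Rightarrow> real) \<Rightarrow> complex^'n^'n \<Rightarrow> complex^'n^'n" where
  "herm_fun f A = (THE B. \<exists>V l. unitary_mat V \<and>
     A = V ** diag_mat l ** adj_mat V \<and> B = V ** diag_mat (\<lambda>i. f (l i)) ** adj_mat V)"

lemma diag_mat_mult_right: "(A ** diag_mat l) $ i $ j = A $ i $ j * complex_of_real (l j)"
  by (simp add: matrix_matrix_mult_def diag_mat_def if_distrib cong: if_cong)

lemma diag_mat_mult_left: "(diag_mat l ** A) $ i $ j = complex_of_real (l i) * A $ i $ j"
  by (simp add: matrix_matrix_mult_def diag_mat_def if_distrib[where f = "\<lambda>x. x * _"] cong: if_cong)

lemma herm_fun_unique:
  assumes V: "unitary_mat V" and W: "unitary_mat W"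
    and eq: "V ** diag_mat l ** adj_mat V = W ** diag_mat m ** adj_mat W"
  shows "V ** diag_mat (\<lambda>i. f (l i)) ** adj_mat V = W ** diag_mat (\<lambda>i. f (m i)) ** adj_mat W"
proof -
  define P where "P = adj_mat W ** V"
  have WW: "adj_mat W ** W = mat 1" "W ** adj_mat W = mat 1"
    and VV: "adj_mat V ** V = mat 1" "V ** adj_mat V = mat 1"
    using V W by (auto simp: unitary_mat_def)
  have "adj_mat W ** (V ** diag_mat l ** adj_mat V) ** V
      = adj_mat W ** (W ** diag_mat m ** adj_mat W) ** V"
    using eq by simp
  then have "P ** diag_mat l ** (adj_mat V ** V) = (adj_mat W ** W) ** diag_mat m ** P"
    unfolding P_def by (simp only: matrix_mul_assoc)
  then have c: "P ** diag_mat l = diag_mat m ** P"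
    using VV WW by simp
  have "P $ i $ j * complex_of_real (f (l j)) = complex_of_real (f (m i)) * P $ i $ j" for i j
  proof -
    have "P $ i $ j * complex_of_real (l j) = complex_of_real (m i) * P $ i $ j"
      using arg_cong[OF c, of "\<lambda>A. A $ i $ j"]
      by (simp add: diag_mat_mult_left diag_mat_mult_right)
    then show ?thesis by (cases "P $ i $ j = 0") (auto simp: mult.commute)
  qed
  then have c': "P ** diag_mat (\<lambda>i. f (l i)) = diag_mat (\<lambda>i. f (m i)) ** P"
    by (simp add: vec_eq_iff diag_mat_mult_left diag_mat_mult_right)
  have "V ** diag_mat (\<lambda>i. f (l i)) ** adj_mat V
      = (W ** adj_mat W) ** V ** diag_mat (\<lambda>i. f (l i)) ** adj_mat V"
    using WW by simp
  also have "\<dots> = W ** (P ** diag_mat (\<lambda>i. f (l i))) ** adj_mat V"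
    unfolding P_def by (simp only: matrix_mul_assoc)
  also have "\<dots> = W ** diag_mat (\<lambda>i. f (m i)) ** adj_mat W ** (V ** adj_mat V)"
    unfolding c' unfolding P_def by (simp only: matrix_mul_assoc)
  finally show ?thesis using VV by simp
qed

lemma herm_fun_eq:
  assumes "unitary_mat V"
  shows "herm_fun f (V ** diag_mat l ** adj_mat V) = V ** diag_mat (\<lambda>i. f (l i)) ** adj_mat V"
  unfolding herm_fun_def
proof (rule the_equality)
  show "\<exists>W m. unitary_mat W \<and> V ** diag_mat l ** adj_mat V = W ** diag_mat m ** adj_mat W \<and>
      V ** diag_mat (\<lambda>i. f (l i)) ** adj_mat V = W ** diag_mat (\<lambda>i. f (m i)) ** adj_mat W"
    using assms by blast
next
  fix B assume "\<exists>W m. unitary_mat W \<and>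
      V ** diag_mat l ** adj_mat V = W ** diag_mat m ** adj_mat W \<and>
      B = W ** diag_mat (\<lambda>i. f (m i)) ** adj_mat W"
  then show "B = V ** diag_mat (\<lambda>i. f (l i)) ** adj_mat V"
    using herm_fun_unique[OF assms] by metis
qed

text \<open>\<open>tr (X (log X - log U))\<close>. The term \<open>X log X\<close> is the spectral function of \<open>x \<mapsto> x ln x\<close>, whose
  value at \<open>0\<close> is \<open>0\<close>.\<close>

definition quantum_rel_entropy :: "complex^'n^'n \<Rightarrow> complex^'n^'n \<Rightarrow> real" where
  "quantum_rel_entropy X U = Re (trace (herm_fun (\<lambda>x. x * ln x) X - X ** herm_fun ln U))"

text \<open>Functions on the spectraplex are represented by total functions; only their values on
  \<open>Spectraplex\<close> are ever used. At a relative interior point, differentiating within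
  \<open>Spectraplex\<close> is the same as differentiating within its affine hull, and it determines the
  differential exactly along traceless Hermitian directions, so that \<open>G\<close> below is unique.\<close>

definition has_tangent_gradient ::
    "(complex^'n^'n \<Rightarrow> real) \<Rightarrow> complex^'n^'n \<Rightarrow> complex^'n^'n \<Rightarrow> bool" where
  "has_tangent_gradient F G U \<longleftrightarrow>
     G \<in> traceless_herm \<and> (F has_derivative herm_inner G) (at U within Spectraplex)"

definition tangent_gradient :: "(complex^'n^'n \<Rightarrow> real) \<Rightarrow> complex^'n^'n \<Rightarrow> complex^'n^'n" where
  "tangent_gradient F U = (THE G. has_tangent_gradient F G U)"

definition Ent :: "real \<Rightarrow> (complex^'n^'n \<Rightarrow> real) set" where
  "Ent L = {F. convex_on Spectraplex F \<and>
     (\<forall>U\<in>rel_interior Spectraplex. \<exists>G. has_tangent_gradient F G U) \<and>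
     continuous_on (rel_interior Spectraplex) (tangent_gradient F) \<and>
     (\<forall>X\<in>Spectraplex. \<forall>U\<in>rel_interior Spectraplex.
        0 \<le> F X - F U - herm_inner (tangent_gradient F U) (X - U) \<and>
        F X - F U - herm_inner (tangent_gradient F U) (X - U) \<le> L * quantum_rel_entropy X U)}"

type_synonym 'n answer = "real \<times> (complex^'n^'n)"

text \<open>The \<open>k\<close>-fold power of \<open>\<real> \<times> traceless_herm\<close>, as lists in chronological order.\<close>

definition transcripts :: "nat \<Rightarrow> 'n::finite answer list set" where
  "transcripts k = {xs \<in> lists (UNIV \<times> traceless_herm). length xs = k}"

definition deterministic_method ::
    "nat \<Rightarrow> (nat \<Rightarrow> 'n::finite answer list \<Rightarrow> complex^'n^'n) \<Rightarrow>
     ('n answer list \<Rightarrow> complex^'n^'n) \<Rightarrow> bool" where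
  "deterministic_method T \<Phi> \<Phi>out \<longleftrightarrow>
     (\<forall>t\<in>{1..T}. \<Phi> t \<in> transcripts (t - 1) \<rightarrow> rel_interior Spectraplex) \<and>
     \<Phi>out \<in> transcripts T \<rightarrow> Spectraplex"

primrec answers ::
    "(nat \<Rightarrow> 'n::finite answer list \<Rightarrow> complex^'n^'n) \<Rightarrow> (complex^'n^'n \<Rightarrow> real) \<Rightarrow>
     nat \<Rightarrow> 'n answer list" where
  "answers \<Phi> F 0 = []"
| "answers \<Phi> F (Suc t) =
     (let X = \<Phi> (Suc t) (answers \<Phi> F t) in answers \<Phi> F t @ [(F X, tangent_gradient F X)])"

definition returned_point ::
    "nat \<Rightarrow> (nat \<Rightarrow> 'n::finite answer list \<Rightarrow> complex^'n^'n) \<Rightarrow>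
     ('n answer list \<Rightarrow> complex^'n^'n) \<Rightarrow> (complex^'n^'n \<Rightarrow> real) \<Rightarrow> complex^'n^'n" where
  "returned_point T \<Phi> \<Phi>out F = \<Phi>out (answers \<Phi> F T)"

end

theory Submission
  imports Defs
begin

text \<open>The functions that defeat a method have the form \<open>F X = L * f (diag X)\<close>, where \<open>diag X\<close> is
  the vector of diagonal entries of \<open>X\<close>, a point of the probability simplex, and \<open>f\<close> is an
  entropic Moreau envelope of a maximum of affine functions of single coordinates:
  \<open>f x = min\<^sub>z (max\<^sub>i (b\<^sub>i - z\<^sub>i / 2) + KL x z)\<close>, where \<open>i\<close> ranges over a small set of indices,
  \<open>b\<^sub>i\<close> is a small bonus and \<open>KL x z = (\<Sum>i. x\<^sub>i ln (x\<^sub>i / z\<^sub>i) - x\<^sub>i + z\<^sub>i)\<close>. Minimising over \<open>z\<close>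
  for fixed weights \<open>w\<close> of the maximum gives \<open>z\<^sub>i = x\<^sub>i / (1 - w\<^sub>i / 2)\<close> and the dual form
  \<open>f x = max\<^sub>w (\<Sum>i. b\<^sub>i w\<^sub>i + x\<^sub>i ln (1 - w\<^sub>i / 2))\<close>, with \<open>w\<close> ranging over the probability
  vectors on the index set (\<open>smooth_max\<close>). In this form \<open>f\<close> is a maximum of affine functions of
  \<open>x\<close>, hence convex, and its gradient has the entries \<open>ln (1 - w\<^sub>i / 2)\<close> for the optimal \<open>w\<close>. The
  primal form shows that \<open>f\<close> is smooth relative to the entropy with constant \<open>1\<close>, because \<open>KL x z\<close>
  differs from the negative entropy of \<open>x\<close> by an affine function of \<open>x\<close> (\<open>smooth_max_below_kl\<close>).

  On diagonal matrices this already is the required smoothness. It passes to all matrices because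
  the relative entropy does not increase when the off-diagonal entries are erased
  (\<open>quantum_rel_entropy_ge_diagonal_kl\<close>). The integral
  \<open>x ln (x / y) - x + y = \<integral>\<^sub>0\<^sup>1 (1 - t) (x - y)\<^sup>2 / ((1 - t) y + t x) dt\<close> reduces this to the same
  statement for quotients of quadratic by linear expressions, where it is a completion of squares
  in the two eigenbases.

  Relative smoothness allows \<open>f\<close> to be almost nonsmooth where coordinates are small, and this is
  what the adversary exploits. Let \<open>N = T + 1\<close> and \<open>\<epsilon> = 1 / (8 N\<^sup>2)\<close>. Whenever a point is queried,
  some coordinate that was not used before is at most \<open>\<epsilon>\<close>, since the dimension is at least
  \<open>8 N\<^sup>2 + T\<close>. The adversary adds this coordinate to the index set, with a bonus that exceeds all
  later bonuses by at least \<open>\<epsilon>\<close>. At the queried point the later coordinates then have weight \<open>0\<close>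
  (\<open>optimal_extend\<close>), so value and gradient do not depend on them and all answers are consistent
  with the final function (\<open>answers_consistent\<close>). The last coordinate, with bonus \<open>0\<close>, is chosen
  small at the returned point, where therefore \<open>f > - \<epsilon>\<close>. Spreading the mass evenly over the \<open>N\<close>
  chosen coordinates yields \<open>f \<le> \<epsilon> T - 1 / (2 N)\<close>. The gap exceeds
  \<open>1 / (2 N) - \<epsilon> N = 3 / (8 N) > 1 / (4 N)\<close>.\<close>

section \<open>Scalar inequalities for the logarithm and the relative entropy\<close>

text \<open>Applying \<open>ln s \<le> s - 1\<close> to \<open>s = sqrt r\<close> leaves room for a quadratic term.\<close>

lemma ln_le_quadratic:
  fixes r :: real
  assumes "0 < r" "r \<le> 2"
  shows "ln r \<le> r - 1 - (r - 1)\<^sup>2 / 8"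
proof -
  define s where "s = sqrt r"
  have s: "0 < s" "r = s\<^sup>2" using assms by (auto simp: s_def)
  have "ln r = 2 * ln s" unfolding s(2) using s(1) by (simp add: ln_realpow)
  also have "\<dots> \<le> 2 * (s - 1)" using ln_le_minus_one[OF s(1)] by simp
  also have "\<dots> \<le> r - 1 - (r - 1)\<^sup>2 / 8"
  proof -
    have "s\<^sup>2 \<le> (3/2)\<^sup>2" using assms(2) s(2) by (simp add: power2_eq_square)
    then have "s \<le> 3/2" by (rule power2_le_imp_le) simp
    then have "(s + 1)\<^sup>2 \<le> (5/2)\<^sup>2" using s(1) by (intro power_mono) auto
    then have "(s + 1)\<^sup>2 \<le> 8" by (simp add: power2_eq_square)
    then have "(s - 1)\<^sup>2 * (s + 1)\<^sup>2 \<le> (s - 1)\<^sup>2 * 8"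
      by (intro mult_left_mono) auto
    moreover have "(s\<^sup>2 - 1)\<^sup>2 = (s - 1)\<^sup>2 * (s + 1)\<^sup>2" by algebra
    moreover have "s\<^sup>2 - 1 - 2 * (s - 1) = (s - 1)\<^sup>2" by algebra
    ultimately show ?thesis unfolding s(2) by linarith
  qed
  finally show ?thesis .
qed

text \<open>The second derivative of \<open>w \<mapsto> ln (1 - w / 2)\<close> is at most \<open>- 1 / 4\<close> on the unit interval, so
  some quadratic term can be subtracted from the tangent. Strong concavity makes the optimal
  weights below unique and continuous in the point.\<close>

lemma ln_one_minus_half_strong_concave:
  fixes v w :: real
  assumes "0 \<le> v" "v \<le> 1" "0 \<le> w" "w \<le> 1"
  shows "ln (1 - v/2) \<le> ln (1 - w/2) - (v - w) / (2 * (1 - w/2)) - (v - w)\<^sup>2 / 32"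
proof -
  define c where "c = 1 - w/2"
  define r where "r = (1 - v/2) / c"
  have c: "1/2 \<le> c" "c \<le> 1" using assms by (auto simp: c_def)
  have r: "0 < r" "r \<le> 2" using assms c by (auto simp: r_def divide_simps)
  have r1: "r - 1 = - (v - w) / (2 * c)" using c by (simp add: r_def c_def field_simps)
  have "ln (1 - v/2) = ln r + ln c"
    using assms c by (simp add: r_def ln_div)
  also have "\<dots> \<le> r - 1 - (r - 1)\<^sup>2 / 8 + ln c" using ln_le_quadratic[OF r] by simp
  also have "\<dots> \<le> r - 1 - (v - w)\<^sup>2 / 4 / 8 + ln c"
  proof -
    have "(2 * c)\<^sup>2 \<le> 2\<^sup>2" using c by (intro power_mono) auto
    then have "(v - w)\<^sup>2 / 4 \<le> (v - w)\<^sup>2 / (2 * c)\<^sup>2"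
      using c by (intro divide_left_mono) (auto simp: power2_eq_square)
    also have "\<dots> = (r - 1)\<^sup>2" unfolding r1 by (simp add: power_divide power2_commute)
    finally show ?thesis by simp
  qed
  finally show ?thesis unfolding r1 minus_divide_left[symmetric] by (simp add: c_def)
qed

text \<open>The contribution of one coordinate to the relative entropy. The term \<open>y - x\<close> makes every
  single contribution nonnegative and cancels in the sum over two vectors of equal mass.\<close>

definition kl :: "real \<Rightarrow> real \<Rightarrow> real" where
  "kl x y = x * ln x - x * ln y - x + y"

text \<open>The right-hand side minus the left-hand side is the relative entropy of \<open>x\<close> and \<open>c * y\<close>. In
  the smoothness estimate \<open>c\<close> is the factor \<open>1 - v / 2\<close> of a competing weight \<open>v\<close>.\<close>

lemma kl_ge:
  assumes "0 \<le> x" "0 < y" "0 < c"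
  shows "x * ln c \<le> c * y - y + kl x y"
proof (cases "x = 0")
  case True
  then show ?thesis using assms by (simp add: kl_def)
next
  case False
  then have x: "0 < x" using assms by simp
  have "x * ln (c * y / x) \<le> x * (c * y / x - 1)"
    using assms x by (intro mult_left_mono ln_le_minus_one) auto
  then show ?thesis
    using assms x by (simp add: kl_def ln_mult ln_div algebra_simps)
qed

lemma kl_le_chi_square:
  assumes "0 \<le> x" "0 < y"
  shows "kl x y \<le> (x - y)\<^sup>2 / y"
proof (cases "x = 0")
  case True
  then show ?thesis using assms by (simp add: kl_def power2_eq_square)
next
  case False
  then have x: "0 < x" using assms by simp
  have "x * ln (x / y) \<le> x * (x / y - 1)"
    using assms x by (intro mult_left_mono ln_le_minus_one) auto
  then show ?thesis
    using assms x by (simp add: kl_def ln_div field_simps power2_eq_square)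
qed

text \<open>Taylor's formula with integral remainder for \<open>x \<mapsto> x ln x\<close>: the antiderivative of the
  integrand is \<open>t \<mapsto> - kl x (m t)\<close>, where \<open>m t\<close> moves linearly from \<open>y\<close> to \<open>x\<close>. Only continuity is
  available at \<open>t = 1\<close> if \<open>x = 0\<close>, where the integrand becomes \<open>0 / 0\<close>.\<close>

lemma kl_has_integral:
  assumes "0 \<le> x" "0 < y"
  shows "((\<lambda>t. (1 - t) * (x - y)\<^sup>2 / ((1 - t) * y + t * x)) has_integral kl x y) {0..1}"
proof -
  define m where "m t = (1 - t) * y + t * x" for t
  have m: "0 < m t" if "0 \<le> t" "t < 1" for t
    using that assms unfolding m_def by (intro add_pos_nonneg) auto
  have d: "((\<lambda>t. - kl x (m t)) has_vector_derivative (1 - t) * (x - y)\<^sup>2 / m t) (at t)"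
    if "t \<in> {0<..<1}" for t
  proof -
    have mt: "0 < m t" using m that by auto
    have dm: "(m has_field_derivative (x - y)) (at t)"
      unfolding m_def by (auto intro!: derivative_eq_intros)
    have "((\<lambda>t. - kl x (m t)) has_field_derivative (x * ((x - y) / m t) - (x - y))) (at t)"
      unfolding kl_def using mt dm by (auto intro!: derivative_eq_intros)
    moreover have "x * ((x - y) / m t) - (x - y) = (1 - t) * (x - y)\<^sup>2 / m t"
      using mt by (simp add: field_simps) (simp add: m_def algebra_simps power2_eq_square)
    ultimately show ?thesis
      by (simp add: has_real_derivative_iff_has_vector_derivative)
  qed
  have "continuous_on {0..1} (\<lambda>t. - kl x (m t))"
  proof (cases "x = 0")
    case True
    then have "(\<lambda>t. - kl x (m t)) = (\<lambda>t. (t - 1) * y)" by (auto simp: kl_def m_def algebra_simps)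
    then show ?thesis by (simp only:) (intro continuous_intros)
  next
    case False
    then have "m t \<noteq> 0" if "t \<in> {0..1}" for t
      using m[of t] that assms by (cases "t = 1") (auto simp: m_def)
    moreover have "continuous_on {0..1} m"
      unfolding m_def by (intro continuous_intros)
    ultimately show ?thesis unfolding kl_def
      by (intro continuous_intros) auto
  qed
  from fundamental_theorem_of_calculus_interior[OF _ this d]
  have "((\<lambda>t. (1 - t) * (x - y)\<^sup>2 / m t) has_integral (kl x (m 0) - kl x (m 1))) {0..1}"
    by simp
  then show ?thesis by (simp add: m_def kl_def)
qed

section \<open>Entropic smoothing of a maximum\<close>

text \<open>A partial map \<open>b\<close> carries both the index set, as its domain, and the bonuses. The weights
  are the probability vectors supported on that domain.\<close>

definition weights :: "('n::finite \<Rightarrow> real option) \<Rightarrow> (real^'n) set" where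
  "weights b = {w. (\<forall>i. 0 \<le> w $ i) \<and> (\<forall>i. b i = None \<longrightarrow> w $ i = 0) \<and> (\<Sum>i\<in>UNIV. w $ i) = 1}"

definition payoff :: "('n::finite \<Rightarrow> real option) \<Rightarrow> real^'n \<Rightarrow> real^'n \<Rightarrow> real" where
  "payoff b w x = (\<Sum>i\<in>UNIV. the (b i) * w $ i + x $ i * ln (1 - w $ i / 2))"

definition smooth_max :: "('n::finite \<Rightarrow> real option) \<Rightarrow> real^'n \<Rightarrow> real" where
  "smooth_max b x = (SUP w\<in>weights b. payoff b w x)"

text \<open>The partial derivative of \<open>payoff b w u\<close> with respect to \<open>w\<^sub>i\<close>.\<close>

definition slope :: "('n::finite \<Rightarrow> real option) \<Rightarrow> real^'n \<Rightarrow> real^'n \<Rightarrow> 'n \<Rightarrow> real" where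
  "slope b u w i = the (b i) - u $ i / (2 - w $ i)"

text \<open>The first-order condition for a maximiser of the concave function \<open>w \<mapsto> payoff b w u\<close>. As a
  variational inequality it can be transferred between different index sets, and it is exactly
  what the smoothness estimate uses.\<close>

definition optimal :: "('n::finite \<Rightarrow> real option) \<Rightarrow> real^'n \<Rightarrow> real^'n \<Rightarrow> bool" where
  "optimal b u w \<longleftrightarrow> w \<in> weights b \<and>
     (\<forall>v\<in>weights b. (\<Sum>i\<in>UNIV. slope b u w i * (v $ i - w $ i)) \<le> 0)"

lemma weights_bounds:
  assumes "w \<in> weights b"
  shows "0 \<le> w $ i" "w $ i \<le> 1"
proof -
  show "0 \<le> w $ i" using assms by (simp add: weights_def)
  have "w $ i \<le> (\<Sum>i\<in>UNIV. w $ i)"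
    using assms by (intro member_le_sum) (auto simp: weights_def)
  then show "w $ i \<le> 1" using assms by (simp add: weights_def)
qed

lemma ln_weight_bounds:
  assumes "w \<in> weights b"
  shows "-1 \<le> ln (1 - w $ i / 2)" "ln (1 - w $ i / 2) \<le> 0"
proof -
  have w: "0 \<le> w $ i" "w $ i \<le> 1" using weights_bounds[OF assms] by auto
  \<comment> \<open>The lower bound is \<open>- ln 2\<close>, and \<open>ln 2 \<le> 1\<close>.\<close>
  have "ln (1/2) \<le> ln (1 - w $ i / 2)" using w by simp
  moreover have "- ln (1/2::real) \<le> 1" using ln_le_minus_one[of 2] by (simp add: ln_div)
  ultimately show "-1 \<le> ln (1 - w $ i / 2)" by linarith
  show "ln (1 - w $ i / 2) \<le> 0" using w by simp
qed

lemma compact_weights: "compact (weights b)"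
proof -
  have "weights b = (\<Inter>i. {w. 0 \<le> w $ i}) \<inter> (\<Inter>i\<in>{i. b i = None}. {w. w $ i = 0})
      \<inter> {w. (\<Sum>i\<in>UNIV. w $ i) = 1}"
    by (auto simp: weights_def)
  moreover have "closed \<dots>"
    by (intro closed_Int closed_INT ballI closed_Collect_le closed_Collect_eq continuous_intros)
  ultimately have "closed (weights b)" by simp
  moreover have "bounded (weights b)"
  proof (rule bounded_subset[OF bounded_cbox])
    show "weights b \<subseteq> cbox (\<chi> i. 0) (\<chi> i. 1)"
      by (intro subsetI) (simp add: mem_box_cart weights_bounds(1)[where b = b] weights_bounds(2)[where b = b])
  qed
  ultimately show ?thesis by (simp add: compact_eq_bounded_closed)
qed

lemma axis_in_weights: "i \<in> dom b \<Longrightarrow> axis i 1 \<in> weights b"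
  by (auto simp: weights_def axis_def)

lemma weights_mono: "b \<subseteq>\<^sub>m b' \<Longrightarrow> weights b \<subseteq> weights b'"
  by (auto simp: weights_def map_le_def dom_def) (metis not_None_eq)

lemma convex_weights:
  assumes "v \<in> weights b" "w \<in> weights b" "0 \<le> s" "s \<le> 1"
  shows "w + s *\<^sub>R (v - w) \<in> weights b"
proof -
  have "0 \<le> (1 - s) * w $ i + s * v $ i" for i
    using assms weights_bounds(1) by (intro add_nonneg_nonneg mult_nonneg_nonneg) auto
  then have "0 \<le> w $ i + s * (v $ i - w $ i)" for i
    by (simp add: algebra_simps)
  moreover have "(\<Sum>i\<in>UNIV. w $ i + s * (v $ i - w $ i)) = 1"
  proof -
    have "(\<Sum>i\<in>UNIV. w $ i + s * (v $ i - w $ i))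
        = (\<Sum>i\<in>UNIV. w $ i) + s * ((\<Sum>i\<in>UNIV. v $ i) - (\<Sum>i\<in>UNIV. w $ i))"
      unfolding sum.distrib sum_distrib_left[symmetric] sum_subtractf ..
    then show ?thesis using assms by (simp add: weights_def)
  qed
  ultimately show ?thesis
    using assms(1,2) by (simp add: weights_def)
qed

lemma smooth_max_attained:
  assumes "dom b \<noteq> {}"
  obtains w where "w \<in> weights b" "smooth_max b x = payoff b w x"
    "\<And>v. v \<in> weights b \<Longrightarrow> payoff b v x \<le> payoff b w x"
proof -
  have "continuous_on (weights b) (\<lambda>w. payoff b w x)"
    unfolding payoff_def
  proof (intro continuous_intros ballI)
    fix i w assume "w \<in> weights b"
    then show "1 - w $ i / 2 \<noteq> 0" using weights_bounds(2)[of w b i] by simp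
  qed auto
  moreover obtain i where "i \<in> dom b" using assms by blast
  ultimately obtain w where w: "w \<in> weights b" "\<forall>v\<in>weights b. payoff b v x \<le> payoff b w x"
    using continuous_attains_sup[OF compact_weights] axis_in_weights by blast
  then have "smooth_max b x = payoff b w x"
    unfolding smooth_max_def by (intro cSup_eq_maximum) auto
  with w that show ?thesis by blast
qed

lemma smooth_max_ge:
  assumes "w \<in> weights b"
  shows "payoff b w x \<le> smooth_max b x"
proof -
  have "dom b \<noteq> {}" using assms by (force simp: weights_def)
  then show ?thesis using smooth_max_attained assms by metis
qed

text \<open>Summing the strong concavity of the single terms bounds the payoff by its linearisation at
  \<open>w\<close> minus a quadratic term, and optimality says that the linear part does not increase.\<close>

lemma payoff_le_optimal:
  assumes "optimal b u w" "v \<in> weights b" "\<And>i. 0 \<le> u $ i"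
  shows "payoff b v u \<le> payoff b w u - (\<Sum>i\<in>UNIV. u $ i * (v $ i - w $ i)\<^sup>2) / 32"
proof -
  have w: "w \<in> weights b" using assms by (simp add: optimal_def)
  have "the (b i) * v $ i + u $ i * ln (1 - v $ i / 2)
      \<le> (the (b i) * w $ i + u $ i * ln (1 - w $ i / 2)) - u $ i * (v $ i - w $ i)\<^sup>2 / 32
        + slope b u w i * (v $ i - w $ i)" for i
  proof -
    have "u $ i * ln (1 - v $ i / 2) \<le> u $ i * (ln (1 - w $ i / 2)
        - (v $ i - w $ i) / (2 * (1 - w $ i / 2)) - (v $ i - w $ i)\<^sup>2 / 32)"
      using assms(3) weights_bounds[OF w] weights_bounds[OF assms(2)]
      by (intro mult_left_mono ln_one_minus_half_strong_concave) auto
    moreover have "u $ i * (ln (1 - w $ i / 2)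
        - (v $ i - w $ i) / (2 * (1 - w $ i / 2)) - (v $ i - w $ i)\<^sup>2 / 32)
      = u $ i * ln (1 - w $ i / 2) - u $ i * (v $ i - w $ i)\<^sup>2 / 32
        + (slope b u w i * (v $ i - w $ i) - the (b i) * (v $ i - w $ i))"
    proof -
      have "2 * (1 - w $ i / 2) = 2 - w $ i" by simp
      then show ?thesis unfolding slope_def
        by (simp only:) (simp add: left_diff_distrib right_diff_distrib diff_divide_distrib)
    qed
    moreover have "the (b i) * (v $ i - w $ i) = the (b i) * v $ i - the (b i) * w $ i"
      by (rule right_diff_distrib)
    ultimately show ?thesis by linarith
  qed
  then have "payoff b v u \<le> payoff b w u - (\<Sum>i\<in>UNIV. u $ i * (v $ i - w $ i)\<^sup>2) / 32
      + (\<Sum>i\<in>UNIV. slope b u w i * (v $ i - w $ i))"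
    unfolding payoff_def sum_divide_distrib sum_subtractf[symmetric] sum.distrib[symmetric]
    by (intro sum_mono) auto
  also have "(\<Sum>i\<in>UNIV. slope b u w i * (v $ i - w $ i)) \<le> 0"
    using assms by (simp add: optimal_def)
  finally show ?thesis by simp
qed

lemma smooth_max_eq_payoff:
  assumes "optimal b u w" "\<And>i. 0 \<le> u $ i"
  shows "smooth_max b u = payoff b w u"
proof -
  have w: "w \<in> weights b" using assms by (simp add: optimal_def)
  have "payoff b v u \<le> payoff b w u" if "v \<in> weights b" for v
  proof -
    have "0 \<le> (\<Sum>i\<in>UNIV. u $ i * (v $ i - w $ i)\<^sup>2)" using assms(2) by (intro sum_nonneg) simp
    then show ?thesis using payoff_le_optimal[OF assms(1) that assms(2)] by simp
  qed
  then show ?thesis unfolding smooth_max_def using w by (intro cSup_eq_maximum) auto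
qed

lemma payoff_term_derivative:
  fixes a u w h :: real
  assumes "w < 2"
  shows "((\<lambda>s. a * (w + s * h) + u * ln (1 - (w + s * h) / 2)) has_field_derivative (a - u / (2 - w)) * h) (at 0)"
proof -
  have "((\<lambda>s. a * (w + s * h) + u * ln (1 - (w + s * h) / 2))
      has_field_derivative a * h + u * (- (h / 2) / (1 - w / 2))) (at 0)"
    using assms by (auto intro!: derivative_eq_intros)
  moreover have "1 - w / 2 = (2 - w) / 2" by simp
  ultimately show ?thesis by (simp add: left_diff_distrib)
qed

text \<open>A maximiser exists by compactness. It satisfies the variational inequality because a
  positive directional derivative towards some \<open>v\<close> would allow an increase.\<close>

lemma optimal_exists:
  assumes "dom b \<noteq> {}"
  shows "\<exists>w. optimal b u w"
proof -
  obtain w where w: "w \<in> weights b"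
    and max: "\<And>v. v \<in> weights b \<Longrightarrow> payoff b v u \<le> payoff b w u"
    using smooth_max_attained[OF assms, of u] by metis
  have "(\<Sum>i\<in>UNIV. slope b u w i * (v $ i - w $ i)) \<le> 0" if v: "v \<in> weights b" for v
  proof (rule ccontr)
    let ?\<phi> = "\<lambda>s. payoff b (w + s *\<^sub>R (v - w)) u"
    assume "\<not> ?thesis"
    moreover have "(?\<phi> has_field_derivative (\<Sum>i\<in>UNIV. slope b u w i * (v $ i - w $ i))) (at 0)"
    proof -
      have "((\<lambda>s. the (b i) * (w + s *\<^sub>R (v - w)) $ i + u $ i * ln (1 - (w + s *\<^sub>R (v - w)) $ i / 2))
          has_field_derivative slope b u w i * (v $ i - w $ i)) (at 0)" for i
        using payoff_term_derivative[of "w $ i" "the (b i)" "v $ i - w $ i" "u $ i"] weights_bounds(2)[OF w, of i]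
        by (simp add: slope_def)
      then show ?thesis unfolding payoff_def by (intro DERIV_sum)
    qed
    ultimately obtain d where d: "0 < d" "\<And>h. 0 < h \<Longrightarrow> h < d \<Longrightarrow> ?\<phi> 0 < ?\<phi> (0 + h)"
      using DERIV_pos_inc_right[where f = ?\<phi> and x = 0] by (auto simp: not_le)
    \<comment> \<open>The increase holds for steps below \<open>d\<close>, and steps up to \<open>1\<close> stay among the weights.\<close>
    define h where "h = min (d / 2) 1"
    have "payoff b w u < payoff b (w + h *\<^sub>R (v - w)) u" using d by (simp add: h_def)
    moreover have "w + h *\<^sub>R (v - w) \<in> weights b"
      using d by (intro convex_weights v w) (auto simp: h_def)
    ultimately show False using max by (meson not_le)
  qed
  then show ?thesis using w by (auto simp: optimal_def)
qed

lemma optimal_unique: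
  assumes "optimal b u w" "optimal b u w'" "\<And>i. 0 < u $ i"
  shows "w' = w"
proof -
  have nn: "0 \<le> u $ i" for i using assms(3) less_imp_le by blast
  have m: "w' \<in> weights b" using assms(2) by (simp add: optimal_def)
  have "(\<Sum>i\<in>UNIV. u $ i * (w' $ i - w $ i)\<^sup>2) \<le> 0"
    using payoff_le_optimal[OF assms(1) m nn] smooth_max_eq_payoff[OF assms(1) nn]
      smooth_max_eq_payoff[OF assms(2) nn] by simp
  moreover have "0 \<le> u $ i * (w' $ i - w $ i)\<^sup>2" for i using nn by simp
  ultimately have "(\<Sum>i\<in>UNIV. u $ i * (w' $ i - w $ i)\<^sup>2) = 0"
    by (intro antisym sum_nonneg) auto
  then have "u $ i * (w' $ i - w $ i)\<^sup>2 = 0" for i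
    using nn by (subst (asm) sum_nonneg_eq_0_iff) auto
  moreover have "u $ i \<noteq> 0" for i using assms(3)[of i] by simp
  ultimately show ?thesis by (simp add: vec_eq_iff)
qed

definition optimal_weights :: "('n::finite \<Rightarrow> real option) \<Rightarrow> real^'n \<Rightarrow> real^'n" where
  "optimal_weights b u = (SOME w. optimal b u w)"

lemma optimal_optimal_weights: "dom b \<noteq> {} \<Longrightarrow> optimal b u (optimal_weights b u)"
  unfolding optimal_weights_def by (rule someI_ex) (rule optimal_exists)

text \<open>Keeping the weights that are optimal at \<open>u\<close> gives a lower bound for the maximum at \<open>x\<close> that
  is affine in \<open>x\<close>.\<close>

lemma smooth_max_above_tangent:
  assumes "optimal b u w" "\<And>i. 0 \<le> u $ i"
  shows "smooth_max b u + (\<Sum>i\<in>UNIV. ln (1 - w $ i / 2) * (x $ i - u $ i)) \<le> smooth_max b x"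
proof -
  have "w \<in> weights b" using assms by (simp add: optimal_def)
  have "smooth_max b u + (\<Sum>i\<in>UNIV. ln (1 - w $ i / 2) * (x $ i - u $ i)) = payoff b w x"
    unfolding smooth_max_eq_payoff[OF assms] payoff_def sum.distrib[symmetric]
    by (intro sum.cong) (auto simp: algebra_simps)
  also have "\<dots> \<le> smooth_max b x" by (rule smooth_max_ge) fact
  finally show ?thesis .
qed

text \<open>This is smoothness relative to the entropy. With \<open>z\<^sub>i = u\<^sub>i / (1 - w\<^sub>i / 2)\<close>, the point at
  which the envelope at \<open>u\<close> is attained, the payoff of any competing weights \<open>v\<close> at \<open>x\<close> is at most
  \<open>(\<Sum>i. v\<^sub>i (b\<^sub>i - z\<^sub>i / 2)) + KL x z\<close> by \<open>kl_ge\<close>; optimality of \<open>w\<close> allows \<open>v\<close> to be replaced by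
  \<open>w\<close> in the first sum, and \<open>KL x z - KL u z\<close> equals \<open>KL x u\<close> plus the linear term of the claim.\<close>

lemma smooth_max_below_kl:
  assumes "optimal b u w" "\<And>i. 0 < u $ i" "\<And>i. 0 \<le> x $ i"
  shows "smooth_max b x \<le> smooth_max b u + (\<Sum>i\<in>UNIV. ln (1 - w $ i / 2) * (x $ i - u $ i))
    + (\<Sum>i\<in>UNIV. kl (x $ i) (u $ i))"
proof -
  have w: "w \<in> weights b" using assms by (simp add: optimal_def)
  then have "dom b \<noteq> {}" by (force simp: weights_def)
  then obtain v where v: "v \<in> weights b" "smooth_max b x = payoff b v x"
    using smooth_max_attained by metis
  have "the (b i) * v $ i + x $ i * ln (1 - v $ i / 2)
      \<le> (the (b i) * w $ i + u $ i * ln (1 - w $ i / 2)) + slope b u w i * (v $ i - w $ i)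
        + ln (1 - w $ i / 2) * (x $ i - u $ i) + kl (x $ i) (u $ i)" for i
  proof -
    define c z where "c = 1 - w $ i / 2" and "z = u $ i / c"
    have c: "0 < c" using weights_bounds(2)[OF w, of i] by (simp add: c_def)
    have z: "0 < z" using c assms(2) by (simp add: z_def)
    have "x $ i * ln (1 - v $ i / 2) \<le> (1 - v $ i / 2) * z - z + kl (x $ i) z"
      using assms(3) z weights_bounds(2)[OF v(1), of i] by (intro kl_ge) auto
    also have "kl (x $ i) z = kl (x $ i) (u $ i) - u $ i + z + x $ i * ln c"
      using assms(2)[of i] c by (simp add: kl_def z_def ln_div algebra_simps)
    finally have 1: "x $ i * ln (1 - v $ i / 2)
        \<le> - (v $ i * (z / 2)) + z + kl (x $ i) (u $ i) - u $ i + x $ i * ln c"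
      by (simp add: algebra_simps)
    have "u $ i = z * c" using c by (simp add: z_def)
    then have u: "u $ i = z - w $ i * (z / 2)" by (simp add: c_def algebra_simps)
    have s: "slope b u w i = the (b i) - z / 2"
      using c by (simp add: slope_def z_def c_def field_simps)
    have "u $ i * ln c + ln c * (x $ i - u $ i) = x $ i * ln c" by (simp add: algebra_simps)
    moreover have "(the (b i) - z / 2) * (v $ i - w $ i)
        = the (b i) * v $ i - the (b i) * w $ i - v $ i * (z / 2) + w $ i * (z / 2)"
      by (simp add: algebra_simps)
    ultimately show ?thesis unfolding s c_def[symmetric] using 1 u by linarith
  qed
  then have "payoff b v x \<le> (\<Sum>i\<in>UNIV. (the (b i) * w $ i + u $ i * ln (1 - w $ i / 2))
      + slope b u w i * (v $ i - w $ i)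
        + ln (1 - w $ i / 2) * (x $ i - u $ i) + kl (x $ i) (u $ i))"
    unfolding payoff_def by (rule sum_mono)
  also have "\<dots> = payoff b w u + (\<Sum>i\<in>UNIV. slope b u w i * (v $ i - w $ i))
      + (\<Sum>i\<in>UNIV. ln (1 - w $ i / 2) * (x $ i - u $ i)) + (\<Sum>i\<in>UNIV. kl (x $ i) (u $ i))"
    unfolding payoff_def sum.distrib ..
  also have "(\<Sum>i\<in>UNIV. slope b u w i * (v $ i - w $ i)) \<le> 0"
    using assms v by (simp add: optimal_def)
  finally show ?thesis
    using smooth_max_eq_payoff[OF assms(1) less_imp_le[OF assms(2)]] v(2) by linarith
qed

text \<open>Every affine piece has slopes in \<open>[-1, 0]\<close>.\<close>

lemma smooth_max_lipschitz:
  assumes "dom b \<noteq> {}"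
  shows "\<bar>smooth_max b x - smooth_max b y\<bar> \<le> (\<Sum>i\<in>UNIV. \<bar>x $ i - y $ i\<bar>)"
proof -
  have "smooth_max b x - smooth_max b y \<le> (\<Sum>i\<in>UNIV. \<bar>x $ i - y $ i\<bar>)" for x y
  proof -
    obtain w where w: "w \<in> weights b" "smooth_max b x = payoff b w x"
      using smooth_max_attained[OF assms] by metis
    have "smooth_max b x - smooth_max b y \<le> payoff b w x - payoff b w y"
      using w smooth_max_ge by simp
    also have "\<dots> = (\<Sum>i\<in>UNIV. (x $ i - y $ i) * ln (1 - w $ i / 2))"
      unfolding payoff_def sum_subtractf[symmetric] by (simp add: algebra_simps)
    also have "\<dots> \<le> (\<Sum>i\<in>UNIV. \<bar>x $ i - y $ i\<bar>)"
    proof (rule sum_mono)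
      fix i
      have "(x $ i - y $ i) * ln (1 - w $ i / 2) \<le> \<bar>x $ i - y $ i\<bar> * \<bar>ln (1 - w $ i / 2)\<bar>"
        by (metis abs_ge_self abs_mult)
      also have "\<dots> \<le> \<bar>x $ i - y $ i\<bar> * 1"
        using ln_weight_bounds[OF w(1), of i] by (intro mult_left_mono) auto
      finally show "(x $ i - y $ i) * ln (1 - w $ i / 2) \<le> \<bar>x $ i - y $ i\<bar>" by simp
    qed
    finally show ?thesis .
  qed
  from this[of x y] this[of y x] show ?thesis by (simp add: abs_minus_commute)
qed

lemma continuous_on_smooth_max:
  assumes "dom b \<noteq> {}"
  shows "continuous_on S (smooth_max b)"
  unfolding continuous_on_def
proof
  fix x assume "x \<in> S"
  show "(smooth_max b \<longlongrightarrow> smooth_max b x) (at x within S)"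
  proof (rule LIM_zero_cancel)
    have "((\<lambda>y. \<Sum>i\<in>UNIV. \<bar>y $ i - x $ i\<bar>) \<longlongrightarrow> (\<Sum>i\<in>UNIV. \<bar>x $ i - x $ i\<bar>)) (at x within S)"
      by (intro tendsto_intros)
    then have "((\<lambda>y. \<Sum>i\<in>UNIV. \<bar>y $ i - x $ i\<bar>) \<longlongrightarrow> 0) (at x within S)" by simp
    then show "((\<lambda>y. smooth_max b y - smooth_max b x) \<longlongrightarrow> 0) (at x within S)"
      by (rule Lim_null_comparison[rotated])
        (simp add: always_eventually smooth_max_lipschitz[OF assms])
  qed
qed

lemma smooth_max_convex:
  assumes "dom b \<noteq> {}" "0 \<le> s" "0 \<le> t" "s + t = 1"
  shows "smooth_max b (s *\<^sub>R x + t *\<^sub>R y) \<le> s * smooth_max b x + t * smooth_max b y"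
proof -
  obtain w where w: "w \<in> weights b"
    "smooth_max b (s *\<^sub>R x + t *\<^sub>R y) = payoff b w (s *\<^sub>R x + t *\<^sub>R y)"
    using smooth_max_attained[OF assms(1)] by metis
  \<comment> \<open>A payoff is affine in the point, so its constant part has to be split with \<open>s + t = 1\<close>.\<close>
  have e: "the (b i) * w $ i = s * (the (b i) * w $ i) + t * (the (b i) * w $ i)" for i
    using assms(4) by (metis distrib_right mult_1)
  have "payoff b w (s *\<^sub>R x + t *\<^sub>R y) = s * payoff b w x + t * payoff b w y"
    unfolding payoff_def sum_distrib_left sum.distrib[symmetric]
    by (rule sum.cong) (use e in \<open>simp_all add: algebra_simps\<close>)
  also have "\<dots> \<le> s * smooth_max b x + t * smooth_max b y"
    using assms w by (intro add_mono mult_left_mono smooth_max_ge) auto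
  finally show ?thesis using w by simp
qed

text \<open>If \<open>w\<close> and \<open>v\<close> are optimal at \<open>u\<close> and \<open>y\<close>, then \<open>v\<close> loses at least a multiple of
  \<open>\<Sum>i. u\<^sub>i (v\<^sub>i - w\<^sub>i)\<^sup>2\<close> against \<open>w\<close> at \<open>u\<close>, but does not lose at \<open>y\<close>; the difference of these
  two comparisons is bounded by the distance of \<open>u\<close> and \<open>y\<close>.\<close>

lemma continuous_on_optimal_weights:
  fixes b :: "'n::finite \<Rightarrow> real option"
  assumes "dom b \<noteq> {}"
  shows "continuous_on {u. \<forall>i. 0 < u $ i} (optimal_weights b)"
  unfolding continuous_on_def
proof
  fix u :: "real^'n" assume "u \<in> {u. \<forall>i. 0 < u $ i}"
  then have u: "0 < u $ i" for i by simp
  then have nn: "0 \<le> u $ i" for i using less_imp_le by blast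
  let ?F = "at u within {u. \<forall>i. 0 < u $ i}"
  define D where "D = (\<lambda>y. \<Sum>i\<in>UNIV. \<bar>u $ i - y $ i\<bar>)"
  have key: "(optimal_weights b y $ i - optimal_weights b u $ i)\<^sup>2 \<le> (32 / u $ i) * D y" if y: "\<And>i. 0 < y $ i" for y i
  proof -
    let ?w = "optimal_weights b u" and ?v = "optimal_weights b y"
    have o: "optimal b u ?w" "optimal b y ?v" using optimal_optimal_weights assms by auto
    have m: "?v \<in> weights b" "?w \<in> weights b" using o by (auto simp: optimal_def)
    have "u $ i * (?v $ i - ?w $ i)\<^sup>2 / 32 \<le> (\<Sum>i\<in>UNIV. u $ i * (?v $ i - ?w $ i)\<^sup>2) / 32"
      using nn by (intro divide_right_mono member_le_sum) auto
    also have "\<dots> \<le> payoff b ?w u - payoff b ?v u"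
      using payoff_le_optimal[OF o(1) m(1) nn] by simp
    also have "\<dots> \<le> payoff b ?w u - payoff b ?v u + (payoff b ?v y - payoff b ?w y)"
      using smooth_max_ge[OF m(2), of y] smooth_max_eq_payoff[OF o(2) less_imp_le[OF y]] by linarith
    also have "\<dots> = (\<Sum>i\<in>UNIV. (u $ i - y $ i) * (ln (1 - ?w $ i / 2) - ln (1 - ?v $ i / 2)))"
      unfolding payoff_def sum_subtractf[symmetric] sum.distrib[symmetric]
      by (rule sum.cong) (auto simp: algebra_simps)
    also have "\<dots> \<le> D y"
      unfolding D_def
    proof (rule sum_mono)
      fix i
      have "(u $ i - y $ i) * (ln (1 - ?w $ i / 2) - ln (1 - ?v $ i / 2))
          \<le> \<bar>u $ i - y $ i\<bar> * \<bar>ln (1 - ?w $ i / 2) - ln (1 - ?v $ i / 2)\<bar>"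
        by (metis abs_ge_self abs_mult)
      also have "\<dots> \<le> \<bar>u $ i - y $ i\<bar> * 1"
        using ln_weight_bounds[OF m(1), of i] ln_weight_bounds[OF m(2), of i]
        by (intro mult_left_mono) auto
      finally show "(u $ i - y $ i) * (ln (1 - ?w $ i / 2) - ln (1 - ?v $ i / 2)) \<le> \<bar>u $ i - y $ i\<bar>"
        by simp
    qed
    finally show ?thesis using u[of i] by (simp add: field_simps)
  qed
  have "((\<lambda>y. optimal_weights b y $ i) \<longlongrightarrow> optimal_weights b u $ i) ?F" for i
  proof -
    have "((\<lambda>y. (32 / u $ i) * D y) \<longlongrightarrow> (32 / u $ i) * D u) ?F"
      unfolding D_def by (intro tendsto_intros)
    then have D0: "((\<lambda>y. (32 / u $ i) * D y) \<longlongrightarrow> 0) ?F" by (simp add: D_def)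
    have "((\<lambda>y. (optimal_weights b y $ i - optimal_weights b u $ i)\<^sup>2) \<longlongrightarrow> 0) ?F"
    proof (rule tendsto_sandwich[OF _ _ tendsto_const D0])
      show "\<forall>\<^sub>F y in ?F. (optimal_weights b y $ i - optimal_weights b u $ i)\<^sup>2 \<le> 32 / u $ i * D y"
        unfolding eventually_at_filter by (rule always_eventually) (use key in blast)
    qed simp
    then have "((\<lambda>y. sqrt ((optimal_weights b y $ i - optimal_weights b u $ i)\<^sup>2)) \<longlongrightarrow> sqrt 0) ?F"
      by (rule tendsto_real_sqrt)
    then have "((\<lambda>y. optimal_weights b y $ i - optimal_weights b u $ i) \<longlongrightarrow> 0) ?F"
      by (simp add: tendsto_rabs_zero_iff)
    then show ?thesis by (simp add: LIM_zero_iff)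
  qed
  then show "(optimal_weights b \<longlongrightarrow> optimal_weights b u) ?F" by (intro vec_tendstoI)
qed

text \<open>A new index \<open>k\<close> does not attract weight if its bonus is smaller than that of some old index
  \<open>i\<close> by at least \<open>u\<^sub>i\<close>. The slope of \<open>k\<close> at weight \<open>0\<close> is at most \<open>b'\<^sub>k\<close>, while the slope of \<open>i\<close>
  is at least \<open>b\<^sub>i - u\<^sub>i\<close> whatever its weight is, since weights are at most \<open>1\<close>. Here the small
  size of a coordinate makes the smoothing almost ineffective.\<close>

lemma optimal_extend:
  assumes opt: "optimal b u w" and sub: "b \<subseteq>\<^sub>m b'" and i: "i \<in> dom b"
    and u: "\<And>k. 0 \<le> u $ k"
    and new: "\<And>k. k \<in> dom b' - dom b \<Longrightarrow> the (b' k) + u $ i \<le> the (b i)"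
  shows "optimal b' u w"
proof -
  have w: "w \<in> weights b" using opt by (simp add: optimal_def)
  define \<mu> where "\<mu> = (\<Sum>k\<in>UNIV. slope b u w k * w $ k)"
  have old: "slope b u w k \<le> \<mu>" if "k \<in> dom b" for k
  proof -
    have "(\<Sum>j\<in>UNIV. slope b u w j * (axis k 1 $ j - w $ j)) \<le> 0"
      using opt axis_in_weights[OF that] by (auto simp: optimal_def)
    moreover have "(\<Sum>j\<in>UNIV. slope b u w j * axis k 1 $ j) = slope b u w k"
      by (simp add: axis_def if_distrib cong: if_cong)
    ultimately show ?thesis by (simp add: \<mu>_def right_diff_distrib sum_subtractf)
  qed
  have same: "slope b' u w k = slope b u w k" if "k \<in> dom b" for k
    using sub that by (simp add: slope_def map_le_def)
  have all: "slope b' u w k \<le> \<mu>" if "k \<in> dom b'" for k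
  proof (cases "k \<in> dom b")
    case True
    then show ?thesis using old same by simp
  next
    case False
    then have "w $ k = 0" using w by (auto simp: weights_def)
    then have "slope b' u w k \<le> the (b' k)" using u by (simp add: slope_def)
    also have "\<dots> \<le> the (b i) - u $ i" using new[of k] that False by simp
    also have "\<dots> \<le> slope b u w i"
    proof -
      have "u $ i / (2 - w $ i) \<le> u $ i / 1"
        using weights_bounds[OF w, of i] u by (intro divide_left_mono) auto
      then show ?thesis by (simp add: slope_def)
    qed
    also have "\<dots> \<le> \<mu>" using old i by simp
    finally show ?thesis .
  qed
  have w': "w \<in> weights b'" using w weights_mono[OF sub] by auto
  have "(\<Sum>k\<in>UNIV. slope b' u w k * (v $ k - w $ k)) \<le> 0" if v: "v \<in> weights b'" for v
  proof -
    have "slope b' u w k * v $ k \<le> \<mu> * v $ k" for k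
    proof (cases "k \<in> dom b'")
      case True
      then show ?thesis using all weights_bounds(1)[OF v] by (intro mult_right_mono) auto
    next
      case False
      then show ?thesis using v by (auto simp: weights_def)
    qed
    then have "(\<Sum>k\<in>UNIV. slope b' u w k * v $ k) \<le> (\<Sum>k\<in>UNIV. \<mu> * v $ k)" by (rule sum_mono)
    also have "\<dots> = \<mu>" using v by (simp add: weights_def sum_distrib_left[symmetric])
    also have "\<mu> = (\<Sum>k\<in>UNIV. slope b' u w k * w $ k)"
      unfolding \<mu>_def
    proof (rule sum.cong[OF refl])
      fix k show "slope b u w k * w $ k = slope b' u w k * w $ k"
        using same[of k] w by (cases "k \<in> dom b") (auto simp: weights_def)
    qed
    finally show ?thesis by (simp add: right_diff_distrib sum_subtractf)
  qed
  then show ?thesis using w' by (simp add: optimal_def)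
qed

lemma smooth_max_extend:
  assumes "b \<subseteq>\<^sub>m b'" "i \<in> dom b" "\<And>k. 0 < u $ k"
    and "\<And>k. k \<in> dom b' - dom b \<Longrightarrow> the (b' k) + u $ i \<le> the (b i)"
  shows "smooth_max b' u = smooth_max b u" "optimal_weights b' u = optimal_weights b u"
proof -
  have nn: "0 \<le> u $ k" for k using assms(3) less_imp_le by blast
  have d: "dom b \<noteq> {}" "dom b' \<noteq> {}" using assms(1,2) map_le_implies_dom_le by blast+
  have o: "optimal b u (optimal_weights b u)" using optimal_optimal_weights d by blast
  have o': "optimal b' u (optimal_weights b u)" using optimal_extend[OF o assms(1,2) nn assms(4)] .
  show "optimal_weights b' u = optimal_weights b u"
    using optimal_unique[OF o' optimal_optimal_weights[OF d(2)] assms(3)] .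
  have w: "optimal_weights b u \<in> weights b" using o by (simp add: optimal_def)
  have "payoff b' (optimal_weights b u) u = payoff b (optimal_weights b u) u"
    unfolding payoff_def
  proof (rule sum.cong[OF refl])
    fix k
    show "the (b' k) * optimal_weights b u $ k + u $ k * ln (1 - optimal_weights b u $ k / 2)
        = the (b k) * optimal_weights b u $ k + u $ k * ln (1 - optimal_weights b u $ k / 2)"
      using w assms(1) by (cases "k \<in> dom b") (auto simp: weights_def map_le_def)
  qed
  then show "smooth_max b' u = smooth_max b u"
    using smooth_max_eq_payoff[OF o nn] smooth_max_eq_payoff[OF o' nn] by simp
qed

section \<open>Diagonalisation of Hermitian matrices and pinching\<close>

definition hdot :: "complex^'n \<Rightarrow> complex^'n \<Rightarrow> complex" where
  "hdot x y = (\<Sum>i\<in>UNIV. cnj (x $ i) * y $ i)"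

lemma inner_eq_Re_hdot: "x \<bullet> y = Re (hdot x y)"
  by (simp add: hdot_def inner_vec_def inner_complex_def)

text \<open>Together with \<open>inner_eq_Re_hdot\<close> this expresses complex orthogonality to \<open>x\<close> as real
  orthogonality to the two vectors \<open>x\<close> and \<open>\<i> *s x\<close>.\<close>

lemma inner_imaginary_multiple: "(\<i> *s x) \<bullet> y = Im (hdot x y)"
  by (simp add: hdot_def inner_vec_def inner_complex_def)

lemma hdot_commute: "hdot y x = cnj (hdot x y)"
  by (simp add: hdot_def mult.commute)

lemma hdot_right: "hdot x (y + z) = hdot x y + hdot x z"
    "hdot x (y - z) = hdot x y - hdot x z" "hdot x (s *\<^sub>R y) = s *\<^sub>R hdot x y"
    "hdot x (c *s y) = c * hdot x y"
  unfolding hdot_def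
  by (simp_all add: sum.distrib[symmetric] sum_subtractf[symmetric] scaleR_sum_right sum_distrib_left
      algebra_simps)

lemma hdot_left_scale: "hdot (c *s x) y = cnj c * hdot x y"
  unfolding hdot_def by (simp add: sum_distrib_left algebra_simps)

lemma hdot_self: "hdot x x = complex_of_real ((norm x)\<^sup>2)"
proof (rule complex_eqI)
  show "Re (hdot x x) = Re (complex_of_real ((norm x)\<^sup>2))"
    using inner_eq_Re_hdot[of x x] by (simp add: power2_norm_eq_inner)
  show "Im (hdot x x) = Im (complex_of_real ((norm x)\<^sup>2))"
    using arg_cong[OF hdot_commute[of x x], of Im] by simp
qed

lemma hdot_adj_mat: "hdot x (M *v y) = hdot (adj_mat M *v x) y"
proof -
  have "hdot x (M *v y) = (\<Sum>i\<in>UNIV. \<Sum>j\<in>UNIV. cnj (x $ i) * (M $ i $ j * y $ j))"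
    by (simp add: hdot_def matrix_vector_mult_def sum_distrib_left)
  also have "\<dots> = (\<Sum>j\<in>UNIV. \<Sum>i\<in>UNIV. cnj (x $ i) * (M $ i $ j * y $ j))"
    by (rule sum.swap)
  also have "\<dots> = (\<Sum>j\<in>UNIV. cnj (\<Sum>i\<in>UNIV. cnj (M $ i $ j) * x $ i) * y $ j)"
    unfolding cnj_sum sum_distrib_right
    by (intro sum.cong refl) simp
  also have "\<dots> = hdot (adj_mat M *v x) y"
    by (simp add: hdot_def matrix_vector_mult_def adj_mat_def)
  finally show ?thesis .
qed

lemma hermitian_hdot: "hermitian_mat A \<Longrightarrow> hdot x (A *v y) = hdot (A *v x) y"
  by (simp add: hdot_adj_mat hermitian_mat_def)

lemma matrix_vector_scaleR: "(A :: complex^'n^'m) *v (s *\<^sub>R x) = s *\<^sub>R (A *v x)"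
  by (simp add: vec_eq_iff matrix_vector_mult_def scaleR_sum_right)

lemma continuous_on_matrix_vector: "continuous_on S (\<lambda>x. (A :: complex^'n^'m) *v x)"
  unfolding matrix_vector_mult_def by (intro continuous_intros)

text \<open>A maximiser \<open>x\<close> of the Rayleigh quotient on the unit sphere of an invariant subspace is an
  eigenvector: perturbing \<open>x\<close> in the direction of the residual \<open>g = A *v x - l *\<^sub>R x\<close>, which lies
  in the subspace, would otherwise increase the quotient to first order.\<close>

lemma hermitian_eigenvector_in_subspace:
  fixes A :: "complex^'n^'n"
  assumes A: "hermitian_mat A"
    and S: "subspace S" "\<And>y. y \<in> S \<Longrightarrow> A *v y \<in> S"
    and ne: "x0 \<in> S" "x0 \<noteq> 0"
  obtains x l where "x \<in> S" "norm x = 1" "A *v x = l *\<^sub>R x"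
proof -
  have "compact (S \<inter> sphere 0 1)"
    by (intro closed_Int_compact closed_subspace S compact_sphere)
  moreover have "(1 / norm x0) *\<^sub>R x0 \<in> S \<inter> sphere 0 1"
    using ne S(1) by (simp add: subspace_scale)
  moreover have "continuous_on (S \<inter> sphere 0 1) (\<lambda>x. x \<bullet> (A *v x))"
    by (intro continuous_intros continuous_on_matrix_vector)
  ultimately obtain x where x: "x \<in> S" "norm x = 1"
    and max: "\<And>y. y \<in> S \<Longrightarrow> norm y = 1 \<Longrightarrow> y \<bullet> (A *v y) \<le> x \<bullet> (A *v x)"
    using continuous_attains_sup[of "S \<inter> sphere 0 1" "\<lambda>x. x \<bullet> (A *v x)"] by fastforce
  define l where "l = x \<bullet> (A *v x)"
  have rayleigh: "y \<bullet> (A *v y) \<le> l * (y \<bullet> y)" if "y \<in> S" for y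
  proof (cases "y = 0")
    case False
    have "((1 / norm y) *\<^sub>R y) \<bullet> (A *v ((1 / norm y) *\<^sub>R y)) \<le> l"
      unfolding l_def using that S(1) False by (intro max) (auto simp: subspace_scale)
    then have "(y \<bullet> (A *v y)) / (norm y)\<^sup>2 \<le> l"
      unfolding matrix_vector_scaleR by (simp add: power2_eq_square)
    then show ?thesis using False by (simp add: divide_le_eq dot_square_norm)
  qed simp
  define g where "g = A *v x - l *\<^sub>R x"
  have g: "g \<in> S" unfolding g_def using S x by (intro subspace_diff subspace_scale) auto
  define c where "c = l * (g \<bullet> g) - g \<bullet> (A *v g)"
  have sym: "x \<bullet> (A *v g) = g \<bullet> (A *v x)"
    by (simp add: inner_eq_Re_hdot hermitian_hdot[OF A, of x g] hdot_commute[of g "A *v x"])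
  \<comment> \<open>The Rayleigh bound at \<open>x + s *\<^sub>R g\<close>, in which the constant terms cancel.\<close>
  have quad: "0 \<le> - 2 * s * (g \<bullet> g) + s\<^sup>2 * c" for s
  proof -
    have "x + s *\<^sub>R g \<in> S" using g x S by (intro subspace_add subspace_scale) auto
    from rayleigh[OF this]
    have "x \<bullet> (A *v x) + s * (x \<bullet> (A *v g)) + s * (g \<bullet> (A *v x)) + s\<^sup>2 * (g \<bullet> (A *v g))
        \<le> l * (x \<bullet> x) + 2 * s * l * (x \<bullet> g) + s\<^sup>2 * l * (g \<bullet> g)"
      unfolding matrix_vector_right_distrib matrix_vector_scaleR
      by (simp add: inner_add_left inner_add_right inner_commute[of g x]
          algebra_simps power2_eq_square)
    moreover have "x \<bullet> x = 1" using x(2) by (simp add: dot_square_norm)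
    moreover have "g \<bullet> g = g \<bullet> (A *v x) - l * (x \<bullet> g)"
      by (subst (2) g_def) (simp add: inner_diff_right inner_commute)
    then have "2 * s * (g \<bullet> g) = 2 * (s * (g \<bullet> (A *v x))) - 2 * s * l * (x \<bullet> g)"
      by (simp only: right_diff_distrib mult.assoc)
    moreover have "s\<^sup>2 * c = s\<^sup>2 * l * (g \<bullet> g) - s\<^sup>2 * (g \<bullet> (A *v g))"
      by (simp add: c_def right_diff_distrib)
    ultimately show ?thesis unfolding sym l_def[symmetric] by simp
  qed
  have "g \<bullet> g = 0"
  proof (rule ccontr)
    assume "g \<bullet> g \<noteq> 0"
    then have G: "0 < g \<bullet> g" using inner_ge_zero[of g] by linarith
    define s where "s = (g \<bullet> g) / (\<bar>c\<bar> + 1)"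
    have s: "0 < s" using G by (simp add: s_def)
    have "s * c \<le> s * (\<bar>c\<bar> + 1)" using s by (intro mult_left_mono) auto
    also have "\<dots> = g \<bullet> g" by (simp add: s_def)
    finally have "s * (s * c) \<le> s * (g \<bullet> g)" using s by (intro mult_left_mono) auto
    moreover have "0 < s * (g \<bullet> g)" using s G by (rule mult_pos_pos)
    ultimately show False using quad[of s] by (simp add: power2_eq_square)
  qed
  then have "A *v x = l *\<^sub>R x" by (simp add: g_def)
  with x that show ?thesis by blast
qed

text \<open>Indexing the eigenvectors by a set of matrix indices lets the induction grow the set up to
  all of \<open>UNIV\<close>. Fewer than \<open>CARD('n)\<close> vectors and their imaginary multiples do not span the real
  vector space of dimension \<open>2 * CARD('n)\<close>, so their complex orthogonal complement contains a
  further eigenvector.\<close>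

lemma hermitian_orthonormal_eigenvectors:
  fixes A :: "complex^'n^'n" and J :: "'n set"
  assumes A: "hermitian_mat A" and J: "finite J"
  shows "\<exists>v l. (\<forall>a\<in>J. \<forall>b\<in>J. hdot (v a) (v b) = (if a = b then 1 else 0)) \<and>
    (\<forall>a\<in>J. A *v v a = complex_of_real (l a) *s v a)"
  using J
proof (induction J rule: finite_induct)
  case empty
  show ?case by simp
next
  case (insert j J)
  then obtain v l where
    ortho: "\<And>a b. a \<in> J \<Longrightarrow> b \<in> J \<Longrightarrow> hdot (v a) (v b) = (if a = b then 1 else 0)"
    and eig: "\<And>a. a \<in> J \<Longrightarrow> A *v v a = complex_of_real (l a) *s v a" by blast
  define S where "S = {x. \<forall>a\<in>J. hdot (v a) x = 0}"
  have S: "subspace S" by (auto simp: S_def subspace_def hdot_right) (simp add: hdot_def)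
  have AS: "A *v y \<in> S" if "y \<in> S" for y
    using that by (simp add: S_def hermitian_hdot[OF A] eig hdot_left_scale)
  have "\<exists>x0. x0 \<in> S \<and> x0 \<noteq> 0"
  proof -
    define B where "B = v ` J \<union> (\<lambda>a. \<i> *s v a) ` J"
    have "card J < CARD('n)" using insert.hyps by (intro psubset_card_mono) auto
    have "dim B \<le> card B" using insert.hyps(1) by (intro dim_le_card') (simp add: B_def)
    also have "\<dots> \<le> card (v ` J) + card ((\<lambda>a. \<i> *s v a) ` J)" unfolding B_def by (rule card_Un_le)
    also have "\<dots> \<le> card J + card J" using insert.hyps(1) by (intro add_mono card_image_le)
    also have "\<dots> < DIM(complex^'n)" using \<open>card J < CARD('n)\<close> by simp
    finally obtain x0 where x0: "x0 \<noteq> 0" "\<And>y. y \<in> span B \<Longrightarrow> orthogonal x0 y"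
      using orthogonal_to_subspace_exists by blast
    have "hdot (v a) x0 = 0" if "a \<in> J" for a
    proof (rule complex_eqI)
      have "v a \<in> span B" "\<i> *s v a \<in> span B" using that by (auto simp: B_def intro!: span_base)
      then have "v a \<bullet> x0 = 0" "(\<i> *s v a) \<bullet> x0 = 0"
        using x0(2) by (auto simp: orthogonal_def inner_commute[of _ x0])
      then show "Re (hdot (v a) x0) = Re 0" "Im (hdot (v a) x0) = Im 0"
        unfolding inner_imaginary_multiple by (simp_all add: inner_eq_Re_hdot)
    qed
    then show ?thesis using x0(1) by (auto simp: S_def)
  qed
  then obtain x m where x: "x \<in> S" "norm x = 1" "A *v x = m *\<^sub>R x"
    using hermitian_eigenvector_in_subspace[OF A S AS] by metis
  have xv: "hdot (v a) x = 0" "hdot x (v a) = 0" if "a \<in> J" for a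
    using x(1) that hdot_commute[of x "v a"] by (auto simp: S_def)
  have xx: "hdot x x = 1" using x(2) by (simp add: hdot_self)
  have "m *\<^sub>R x = complex_of_real m *s x" 
    unfolding vec_eq_iff vector_scaleR_component vector_smult_component by (simp add: scaleR_conv_of_real)
  then have "(\<forall>a\<in>insert j J. \<forall>b\<in>insert j J. hdot ((v(j := x)) a) ((v(j := x)) b) = (if a = b then 1 else 0)) \<and>
    (\<forall>a\<in>insert j J. A *v (v(j := x)) a = complex_of_real ((l(j := m)) a) *s (v(j := x)) a)"
    using insert.hyps(2) ortho eig x(3) xv xx by auto
  then show ?case by blast
qed

lemma adj_mat_mult: "adj_mat (A ** B) = adj_mat B ** adj_mat A"
  by (simp add: adj_mat_def matrix_matrix_mult_def vec_eq_iff mult.commute)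

lemma adj_mat_adj_mat: "adj_mat (adj_mat A) = A"
  by (simp add: adj_mat_def vec_eq_iff)

lemma adj_diag_mat: "adj_mat (diag_mat l) = diag_mat l"
  by (auto simp: adj_mat_def diag_mat_def vec_eq_iff)

theorem hermitian_diagonalisation:
  fixes A :: "complex^'n^'n"
  assumes "hermitian_mat A"
  obtains V l where "unitary_mat V" "A = V ** diag_mat l ** adj_mat V"
proof -
  obtain v :: "'n \<Rightarrow> complex^'n" and l :: "'n \<Rightarrow> real" where vl:
    "\<forall>a\<in>UNIV. \<forall>b\<in>UNIV. hdot (v a) (v b) = (if a = b then 1 else 0)"
    "\<forall>a\<in>UNIV. A *v v a = complex_of_real (l a) *s v a"
    using hermitian_orthonormal_eigenvectors[OF assms finite_class.finite_UNIV] by blast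
  then have ortho: "hdot (v a) (v b) = (if a = b then 1 else 0)"
    and eig: "A *v v a = complex_of_real (l a) *s v a" for a b by auto
  define V where "V = (\<chi> i a. v a $ i)"
  have "(adj_mat V ** V) $ a $ b = hdot (v a) (v b)" for a b
    by (simp add: adj_mat_def matrix_matrix_mult_def hdot_def V_def)
  then have "adj_mat V ** V = mat 1" using ortho by (simp add: vec_eq_iff mat_def)
  then have V: "unitary_mat V" unfolding unitary_mat_def using matrix_left_right_inverse by blast
  have "(A ** V) $ i $ a = (A *v v a) $ i" for i a
    by (simp add: matrix_matrix_mult_def matrix_vector_mult_def V_def)
  then have "A ** V = V ** diag_mat l"
    by (simp add: vec_eq_iff eig diag_mat_mult_right V_def mult.commute)
  then have "A ** (V ** adj_mat V) = V ** diag_mat l ** adj_mat V" by (simp add: matrix_mul_assoc)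
  then have "A = V ** diag_mat l ** adj_mat V" using V by (simp add: unitary_mat_def)
  with V that show ?thesis by blast
qed

lemma eigenvalue_as_quadratic_form:
  assumes V: "unitary_mat V" and A: "A = V ** diag_mat l ** adj_mat V"
  obtains x where "norm x = 1" "hdot x (A *v x) = complex_of_real (l a)"
proof
  define x where "x = V *v axis a 1"
  have "adj_mat V *v x = axis a 1"
    using V by (simp add: x_def matrix_vector_mul_assoc unitary_mat_def)
  moreover have "diag_mat l *v axis a 1 = complex_of_real (l a) *s axis a 1"
  proof -
    have "(diag_mat l *v z) $ i = complex_of_real (l i) * z $ i" for z i
      by (simp add: diag_mat_def matrix_vector_mult_def if_distrib[where f = "\<lambda>c. c * _"] cong: if_cong)
    then show ?thesis by (simp add: vec_eq_iff axis_def)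
  qed
  ultimately have Ax: "A *v x = complex_of_real (l a) *s x"
    unfolding A by (simp add: matrix_vector_mul_assoc[symmetric] x_def vector_scalar_commute)
  have "hdot x x = hdot (adj_mat V *v x) (axis a 1)"
    by (subst (2) x_def) (rule hdot_adj_mat)
  also have "\<dots> = hdot (axis a 1) (axis a 1)" using \<open>adj_mat V *v x = axis a 1\<close> by simp
  also have "\<dots> = 1" by (simp add: hdot_self)
  finally have xx: "hdot x x = 1" .
  then show "hdot x (A *v x) = complex_of_real (l a)" by (simp add: Ax hdot_right)
  from xx have "(norm x)\<^sup>2 = 1" unfolding hdot_self by (metis of_real_eq_1_iff)
  then have "norm x = 1 \<or> norm x = - 1" by (simp add: power2_eq_1_iff)
  then show "norm x = 1" using norm_ge_zero[of x] by linarith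
qed

text \<open>The Frobenius inner product. All traces below are evaluated in this form.\<close>

lemma trace_mult_adj_mat: "trace (M ** adj_mat N) = (\<Sum>a\<in>UNIV. \<Sum>b\<in>UNIV. M $ a $ b * cnj (N $ a $ b))"
  by (simp add: trace_def matrix_matrix_mult_def adj_mat_def)

lemma trace_mult_diag: "trace (A ** diag_mat k) = (\<Sum>i\<in>UNIV. A $ i $ i * complex_of_real (k i))"
  by (simp add: trace_def diag_mat_mult_right)

lemma trace_rotate: "trace (A ** B) = trace (B ** (A :: complex^'n^'n))"
  by (rule trace_mul_sym)

lemma cmod_square: "(complex_of_real (cmod z))\<^sup>2 = z * cnj z"
  using complex_norm_square[of z] by simp

lemma unitary_column_sums:
  assumes "unitary_mat P"
  shows "(\<Sum>b\<in>UNIV. (cmod (P $ a $ b))\<^sup>2) = 1" "(\<Sum>a\<in>UNIV. (cmod (P $ a $ b))\<^sup>2) = 1"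
proof -
  have "(P ** adj_mat P) $ a $ a = 1" "(adj_mat P ** P) $ b $ b = 1"
    using assms by (auto simp: unitary_mat_def mat_def)
  then have "complex_of_real (\<Sum>b\<in>UNIV. (cmod (P $ a $ b))\<^sup>2) = 1"
    "complex_of_real (\<Sum>a\<in>UNIV. (cmod (P $ a $ b))\<^sup>2) = 1"
    by (simp_all add: matrix_matrix_mult_def adj_mat_def cmod_square mult.commute)
  then show "(\<Sum>b\<in>UNIV. (cmod (P $ a $ b))\<^sup>2) = 1" "(\<Sum>a\<in>UNIV. (cmod (P $ a $ b))\<^sup>2) = 1"
    using of_real_eq_1_iff by blast+
qed

text \<open>From here on \<open>X\<close> and \<open>U\<close> are given by their spectral decompositions. The squared moduli of
  the entries of the unitary matrix of overlaps \<open>P\<close> between the two eigenbases form a doubly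
  stochastic matrix, and the quantum relative entropy is the average over this matrix of the
  scalar relative entropies of the eigenvalues.\<close>

context
  fixes V W X U :: "complex^'n^'n" and x y :: "'n \<Rightarrow> real"
  assumes V: "unitary_mat V" and X: "X = V ** diag_mat x ** adj_mat V"
    and W: "unitary_mat W" and U: "U = W ** diag_mat y ** adj_mat W"
    and x: "\<And>a. 0 \<le> x a" and y: "\<And>b. 0 < y b"
begin

private definition "P = adj_mat V ** W"

private lemma VV:
  "adj_mat V ** V = mat 1" "V ** adj_mat V = mat 1" "adj_mat W ** W = mat 1" "W ** adj_mat W = mat 1"
  using V W by (auto simp: unitary_mat_def)

private lemma cancel:
  "M ** V ** adj_mat V = M" "M ** adj_mat V ** V = M" "M ** W ** adj_mat W = M" "M ** adj_mat W ** W = M"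
  by (metis VV matrix_mul_assoc matrix_mul_rid)+

private lemma unitary_overlap: "unitary_mat P"
  unfolding unitary_mat_def P_def adj_mat_mult adj_mat_adj_mat matrix_mul_assoc by (simp add: cancel VV)

private lemma diagonal_entries:
  "X $ i $ i = complex_of_real (\<Sum>a\<in>UNIV. x a * (cmod (V $ i $ a))\<^sup>2)"
  "U $ i $ i = complex_of_real (\<Sum>b\<in>UNIV. y b * (cmod (W $ i $ b))\<^sup>2)"
proof -
  have "(Q ** diag_mat l ** adj_mat Q) $ i $ i = complex_of_real (\<Sum>a\<in>UNIV. l a * (cmod (Q $ i $ a))\<^sup>2)"
    for Q :: "complex^'n^'n" and l
  proof -
    have "(Q ** diag_mat l ** adj_mat Q) $ i $ i
        = (\<Sum>a\<in>UNIV. Q $ i $ a * complex_of_real (l a) * cnj (Q $ i $ a))"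
      by (subst matrix_matrix_mult_def) (simp add: diag_mat_mult_right adj_mat_def)
    also have "\<dots> = (\<Sum>a\<in>UNIV. complex_of_real (l a * (cmod (Q $ i $ a))\<^sup>2))"
      by (intro sum.cong refl) (simp add: cmod_square mult_ac)
    finally show ?thesis by simp
  qed
  then show "X $ i $ i = complex_of_real (\<Sum>a\<in>UNIV. x a * (cmod (V $ i $ a))\<^sup>2)"
    "U $ i $ i = complex_of_real (\<Sum>b\<in>UNIV. y b * (cmod (W $ i $ b))\<^sup>2)"
    unfolding X U by blast+
qed

private lemma diagonal_bounds: "0 \<le> Re (X $ i $ i)" "0 < Re (U $ i $ i)"
proof -
  show "0 \<le> Re (X $ i $ i)" unfolding diagonal_entries using x by (simp add: sum_nonneg)
  have "\<exists>b. W $ i $ b \<noteq> 0"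
    using unitary_column_sums(1)[OF W, of i]
    by (metis (no_types, lifting) norm_zero sum.neutral zero_neq_one zero_power2)
  then obtain b where b: "W $ i $ b \<noteq> 0" ..
  show "0 < Re (U $ i $ i)" unfolding diagonal_entries Re_complex_of_real
  proof (rule sum_pos2[where i = b])
    show "0 < y b * (cmod (W $ i $ b))\<^sup>2" using y[of b] b by simp
    show "0 \<le> y a * (cmod (W $ i $ a))\<^sup>2" for a using y[of a] by simp
  qed simp_all
qed

text \<open>For any real \<open>k\<close>, completing the square gives \<open>d\<^sup>2 / q \<ge> 2 d f - q f\<^sup>2\<close>. On the right-hand
  side of the claim this is applied to each pair of eigenvectors, with \<open>d\<close> and \<open>f\<close> the
  corresponding entries of \<open>X - U\<close> and of the diagonal matrix of \<open>k\<close>. Both \<open>\<Sum> d f\<close> and \<open>\<Sum> q f\<^sup>2\<close>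
  are traces, which can be evaluated in the standard basis, where only the diagonal entries of \<open>X\<close>
  and \<open>U\<close> occur. The choice \<open>k\<^sub>i = (X\<^sub>i\<^sub>i - U\<^sub>i\<^sub>i) / m\<^sub>i\<close> makes the bound equal to the left-hand
  side.\<close>

private lemma chi_square_pinching:
  assumes t: "0 \<le> t" "t < 1"
  shows "(\<Sum>i\<in>UNIV. (Re (X $ i $ i) - Re (U $ i $ i))\<^sup>2 / ((1 - t) * Re (U $ i $ i) + t * Re (X $ i $ i)))
    \<le> (\<Sum>a\<in>UNIV. \<Sum>b\<in>UNIV. (cmod (P $ a $ b))\<^sup>2 * ((x a - y b)\<^sup>2 / ((1 - t) * y b + t * x a)))"
    (is "_ \<le> ?R")
proof -
  define p u m where "p i = Re (X $ i $ i)" and "u i = Re (U $ i $ i)"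
    and "m i = (1 - t) * Re (U $ i $ i) + t * Re (X $ i $ i)" for i
  define k where "k i = (p i - u i) / m i" for i
  define M where "M = adj_mat V ** diag_mat k ** W"
  have m: "0 < m i" for i
    using diagonal_bounds t unfolding m_def by (intro add_pos_nonneg mult_pos_pos mult_nonneg_nonneg) auto
  have Xd: "X $ i $ i = complex_of_real (p i)" and Ud: "U $ i $ i = complex_of_real (u i)" for i
    by (simp_all add: diagonal_entries p_def u_def)
  \<comment> \<open>Cyclic rotation of the trace brings \<open>diag_mat x\<close> between \<open>V\<close> and \<open>adj_mat V\<close>, which restores \<open>X\<close>.\<close>
  have linear:
    "(\<Sum>a\<in>UNIV. \<Sum>b\<in>UNIV. (x a - y b) * Re (P $ a $ b * cnj (M $ a $ b))) 
      = (\<Sum>i\<in>UNIV. k i * (p i - u i))"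
  proof -
    have aM: "adj_mat M = adj_mat W ** diag_mat k ** V"
      by (simp add: M_def adj_mat_mult adj_mat_adj_mat adj_diag_mat matrix_mul_assoc)
    have "trace (diag_mat x ** P ** adj_mat M) = trace (diag_mat x ** adj_mat V ** diag_mat k ** V)"
      unfolding aM P_def matrix_mul_assoc cancel ..
    also have "\<dots> = trace (X ** diag_mat k)"
      unfolding X by (subst trace_rotate) (simp add: matrix_mul_assoc)
    finally have 1: "trace (diag_mat x ** P ** adj_mat M) = (\<Sum>i\<in>UNIV. complex_of_real (p i * k i))"
      by (simp add: trace_mult_diag Xd)
    have "trace (P ** diag_mat y ** adj_mat M) = trace (adj_mat V ** (W ** diag_mat y ** adj_mat W ** diag_mat k ** V))"
      unfolding aM P_def matrix_mul_assoc ..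
    also have "\<dots> = trace (U ** diag_mat k)"
      unfolding U by (subst trace_rotate) (simp add: cancel)
    finally have 2: "trace (P ** diag_mat y ** adj_mat M) = (\<Sum>i\<in>UNIV. complex_of_real (u i * k i))"
      by (simp add: trace_mult_diag Ud)
    have "(\<Sum>a\<in>UNIV. \<Sum>b\<in>UNIV. (x a - y b) * Re (P $ a $ b * cnj (M $ a $ b)))
        = Re (trace (diag_mat x ** P ** adj_mat M)) - Re (trace (P ** diag_mat y ** adj_mat M))"
      unfolding trace_mult_adj_mat diag_mat_mult_left diag_mat_mult_right Re_sum sum_subtractf[symmetric]
      by (intro sum.cong refl) (simp add: algebra_simps)
    then show ?thesis unfolding 1 2 by (simp add: algebra_simps sum_subtractf)
  qed
  \<comment> \<open>The two copies of \<open>diag_mat k\<close> meet after rotation and multiply to the diagonal matrix of the squares.\<close>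
  have quadratic:
    "(\<Sum>a\<in>UNIV. \<Sum>b\<in>UNIV. ((1 - t) * y b + t * x a) * (cmod (M $ a $ b))\<^sup>2)
      = (\<Sum>i\<in>UNIV. (k i)\<^sup>2 * m i)"
  proof -
    have aM: "adj_mat M = adj_mat W ** diag_mat k ** V"
      by (simp add: M_def adj_mat_mult adj_mat_adj_mat adj_diag_mat matrix_mul_assoc)
    have kk: "A ** diag_mat k ** diag_mat k = A ** diag_mat (\<lambda>i. (k i)\<^sup>2)" for A :: "complex^'n^'n"
      by (simp add: vec_eq_iff diag_mat_mult_right power2_eq_square mult.assoc)
    have "trace (diag_mat x ** M ** adj_mat M) = trace (diag_mat x ** adj_mat V ** diag_mat k ** diag_mat k ** V)"
      unfolding aM unfolding M_def matrix_mul_assoc cancel ..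
    also have "\<dots> = trace (X ** diag_mat (\<lambda>i. (k i)\<^sup>2))"
      unfolding X kk by (subst trace_rotate) (simp add: matrix_mul_assoc)
    finally have 1: "trace (diag_mat x ** M ** adj_mat M) = (\<Sum>i\<in>UNIV. complex_of_real (p i * (k i)\<^sup>2))"
      by (simp add: trace_mult_diag Xd)
    have "trace (M ** diag_mat y ** adj_mat M)
        = trace ((adj_mat V ** diag_mat k) ** (W ** diag_mat y ** adj_mat W ** diag_mat k ** V))"
      unfolding aM unfolding M_def matrix_mul_assoc ..
    also have "\<dots> = trace (U ** diag_mat (\<lambda>i. (k i)\<^sup>2))"
      unfolding U by (subst trace_rotate) (simp add: matrix_mul_assoc cancel kk)
    finally have 2: "trace (M ** diag_mat y ** adj_mat M) = (\<Sum>i\<in>UNIV. complex_of_real (u i * (k i)\<^sup>2))"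
      by (simp add: trace_mult_diag Ud)
    have n: "(cmod z)\<^sup>2 = Re (z * cnj z)" for z by (simp add: complex_norm_square[symmetric])
    have "(\<Sum>a\<in>UNIV. \<Sum>b\<in>UNIV. ((1 - t) * y b + t * x a) * (cmod (M $ a $ b))\<^sup>2)
        = (1 - t) * Re (trace (M ** diag_mat y ** adj_mat M)) + t * Re (trace (diag_mat x ** M ** adj_mat M))"
      unfolding trace_mult_adj_mat diag_mat_mult_left diag_mat_mult_right Re_sum sum_distrib_left
        sum.distrib[symmetric] n
      by (intro sum.cong refl) (simp add: algebra_simps)
    also have "\<dots> = (\<Sum>i\<in>UNIV. (k i)\<^sup>2 * m i)"
      unfolding 1 2 Re_sum Re_complex_of_real sum_distrib_left sum.distrib[symmetric]
      by (intro sum.cong refl) (simp add: m_def p_def u_def algebra_simps)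
    finally show ?thesis .
  qed
  have pointwise: "2 * ((x a - y b) * Re (P $ a $ b * cnj (M $ a $ b)))
        - ((1 - t) * y b + t * x a) * (cmod (M $ a $ b))\<^sup>2
      \<le> (cmod (P $ a $ b))\<^sup>2 * ((x a - y b)\<^sup>2 / ((1 - t) * y b + t * x a))" for a b
  proof -
    define q d f where "q = (1 - t) * y b + t * x a" and "d = (x a - y b) * cmod (P $ a $ b)"
      and "f = cmod (M $ a $ b)"
    have q: "0 < q"
      using x[of a] y[of b] t unfolding q_def by (intro add_pos_nonneg mult_pos_pos mult_nonneg_nonneg) auto
    have "(x a - y b) * Re (P $ a $ b * cnj (M $ a $ b)) \<le> \<bar>x a - y b\<bar> * \<bar>Re (P $ a $ b * cnj (M $ a $ b))\<bar>"
      by (metis abs_ge_self abs_mult)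
    also have "\<dots> \<le> \<bar>x a - y b\<bar> * cmod (P $ a $ b * cnj (M $ a $ b))"
      by (intro mult_left_mono abs_Re_le_cmod) simp
    also have "\<dots> = \<bar>d\<bar> * f" by (simp add: d_def f_def norm_mult abs_mult)
    finally have 1: "(x a - y b) * Re (P $ a $ b * cnj (M $ a $ b)) \<le> \<bar>d\<bar> * f" .
    have "(\<bar>d\<bar> - q * f)\<^sup>2 = d\<^sup>2 - q * (2 * (\<bar>d\<bar> * f)) + q * (q * f\<^sup>2)"
      by (simp add: power2_eq_square algebra_simps)
    then have "(\<bar>d\<bar> - q * f)\<^sup>2 / q = d\<^sup>2 / q - 2 * (\<bar>d\<bar> * f) + q * f\<^sup>2"
      using q by (simp add: add_divide_distrib diff_divide_distrib)
    moreover have "0 \<le> (\<bar>d\<bar> - q * f)\<^sup>2 / q" using q by simp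
    ultimately have "2 * (\<bar>d\<bar> * f) - q * f\<^sup>2 \<le> d\<^sup>2 / q" by simp
    moreover have "d\<^sup>2 / q = (cmod (P $ a $ b))\<^sup>2 * ((x a - y b)\<^sup>2 / q)"
      by (simp add: d_def power_mult_distrib mult.commute)
    ultimately show ?thesis using 1 unfolding q_def[symmetric] f_def[symmetric] by linarith
  qed
  have "(\<Sum>i\<in>UNIV. (p i - u i)\<^sup>2 / m i) = 2 * (\<Sum>i\<in>UNIV. k i * (p i - u i)) - (\<Sum>i\<in>UNIV. (k i)\<^sup>2 * m i)"
    unfolding sum_distrib_left sum_subtractf[symmetric]
  proof (intro sum.cong refl)
    fix i
    have "p i - u i = k i * m i" using m[of i] by (simp add: k_def)
    then show "(p i - u i)\<^sup>2 / m i = 2 * (k i * (p i - u i)) - (k i)\<^sup>2 * m i"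
      using m[of i] by (simp add: power2_eq_square)
  qed
  also have "\<dots> = (\<Sum>a\<in>UNIV. \<Sum>b\<in>UNIV. 2 * ((x a - y b) * Re (P $ a $ b * cnj (M $ a $ b)))
      - ((1 - t) * y b + t * x a) * (cmod (M $ a $ b))\<^sup>2)"
    unfolding linear[symmetric] quadratic[symmetric] sum_distrib_left sum_subtractf ..
  also have "\<dots> \<le> ?R" by (intro sum_mono pointwise)
  finally show ?thesis unfolding p_def u_def m_def .
qed

text \<open>Both sides are integrals over \<open>t\<close>, and the integrands satisfy the previous bound times
  \<open>1 - t\<close>.\<close>

private lemma kl_pinching:
  "(\<Sum>i\<in>UNIV. kl (Re (X $ i $ i)) (Re (U $ i $ i)))
    \<le> (\<Sum>a\<in>UNIV. \<Sum>b\<in>UNIV. (cmod (P $ a $ b))\<^sup>2 * kl (x a) (y b))"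
proof (rule has_integral_le)
  show "((\<lambda>t. \<Sum>i\<in>UNIV. (1 - t) * (Re (X $ i $ i) - Re (U $ i $ i))\<^sup>2 / ((1 - t) * Re (U $ i $ i) + t * Re (X $ i $ i)))
      has_integral (\<Sum>i\<in>UNIV. kl (Re (X $ i $ i)) (Re (U $ i $ i)))) {0..1}"
    by (intro has_integral_sum kl_has_integral diagonal_bounds) simp
  show "((\<lambda>t. \<Sum>a\<in>UNIV. \<Sum>b\<in>UNIV. (cmod (P $ a $ b))\<^sup>2 * ((1 - t) * (x a - y b)\<^sup>2 / ((1 - t) * y b + t * x a)))
      has_integral (\<Sum>a\<in>UNIV. \<Sum>b\<in>UNIV. (cmod (P $ a $ b))\<^sup>2 * kl (x a) (y b))) {0..1}"
    by (intro has_integral_sum has_integral_mult_right kl_has_integral x y) simp_all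
  fix t :: real assume "t \<in> {0..1}"
  show "(\<Sum>i\<in>UNIV. (1 - t) * (Re (X $ i $ i) - Re (U $ i $ i))\<^sup>2 / ((1 - t) * Re (U $ i $ i) + t * Re (X $ i $ i)))
      \<le> (\<Sum>a\<in>UNIV. \<Sum>b\<in>UNIV. (cmod (P $ a $ b))\<^sup>2 * ((1 - t) * (x a - y b)\<^sup>2 / ((1 - t) * y b + t * x a)))"
  proof (cases "t = 1")
    case False
    then have t: "0 \<le> t" "t < 1" using \<open>t \<in> {0..1}\<close> by auto
    have "(1 - t) * (\<Sum>i\<in>UNIV. (Re (X $ i $ i) - Re (U $ i $ i))\<^sup>2 / ((1 - t) * Re (U $ i $ i) + t * Re (X $ i $ i)))
      \<le> (1 - t) * (\<Sum>a\<in>UNIV. \<Sum>b\<in>UNIV. (cmod (P $ a $ b))\<^sup>2 * ((x a - y b)\<^sup>2 / ((1 - t) * y b + t * x a)))"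
      using t by (intro mult_left_mono chi_square_pinching) auto
    then show ?thesis unfolding sum_distrib_left times_divide_eq_right mult.left_commute[of "1 - t"] .
  qed simp
qed

private lemma quantum_rel_entropy_in_eigenbases:
  assumes "trace X = trace U"
  shows "quantum_rel_entropy X U = (\<Sum>a\<in>UNIV. \<Sum>b\<in>UNIV. (cmod (P $ a $ b))\<^sup>2 * kl (x a) (y b))"
proof -
  have tr: "trace (Q ** diag_mat l ** adj_mat Q) = complex_of_real (\<Sum>a\<in>UNIV. l a)"
    if "unitary_mat Q" for Q :: "complex^'n^'n" and l
  proof -
    have "trace (Q ** diag_mat l ** adj_mat Q) = trace (adj_mat Q ** Q ** diag_mat l)"
      by (subst trace_rotate) (simp add: matrix_mul_assoc)
    also have "adj_mat Q ** Q = mat 1" using that by (simp add: unitary_mat_def)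
    finally show ?thesis by (simp add: trace_def diag_mat_def)
  qed
  have row: "(\<Sum>a\<in>UNIV. f a) = (\<Sum>a\<in>UNIV. \<Sum>b\<in>UNIV. (cmod (P $ a $ b))\<^sup>2 * f a)" for f :: "'n \<Rightarrow> real"
    by (simp add: sum_distrib_right[symmetric] unitary_column_sums(1)[OF unitary_overlap])
  have col: "(\<Sum>b\<in>UNIV. f b) = (\<Sum>a\<in>UNIV. \<Sum>b\<in>UNIV. (cmod (P $ a $ b))\<^sup>2 * f b)" for f :: "'n \<Rightarrow> real"
    by (subst sum.swap) (simp add: sum_distrib_right[symmetric] unitary_column_sums(2)[OF unitary_overlap])
  have sums: "(\<Sum>a\<in>UNIV. x a) = (\<Sum>b\<in>UNIV. y b)"
    using assms unfolding X U tr[OF V] tr[OF W] by (metis of_real_eq_iff)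
  have XlnU: "trace (X ** herm_fun ln U)
      = (\<Sum>a\<in>UNIV. \<Sum>b\<in>UNIV. complex_of_real ((cmod (P $ a $ b))\<^sup>2 * (x a * ln (y b))))"
  proof -
    have aP: "adj_mat P = adj_mat W ** V" by (simp add: P_def adj_mat_mult adj_mat_adj_mat)
    have "trace (X ** herm_fun ln U)
        = trace (V ** (diag_mat x ** adj_mat V ** W ** diag_mat (\<lambda>b. ln (y b)) ** adj_mat W))"
      unfolding X U herm_fun_eq[OF W] matrix_mul_assoc ..
    also have "\<dots> = trace ((diag_mat x ** P) ** diag_mat (\<lambda>b. ln (y b)) ** adj_mat P)"
      by (subst trace_rotate) (simp only: aP, simp add: P_def matrix_mul_assoc)
    also have "\<dots> = (\<Sum>a\<in>UNIV. \<Sum>b\<in>UNIV. complex_of_real ((cmod (P $ a $ b))\<^sup>2 * (x a * ln (y b))))"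
      unfolding trace_mult_adj_mat diag_mat_mult_right diag_mat_mult_left of_real_mult complex_norm_square
      by (intro sum.cong refl) (simp add: mult_ac)
    finally show ?thesis .
  qed
  have "quantum_rel_entropy X U = (\<Sum>a\<in>UNIV. x a * ln (x a))
      - (\<Sum>a\<in>UNIV. \<Sum>b\<in>UNIV. (cmod (P $ a $ b))\<^sup>2 * (x a * ln (y b)))"
    unfolding quantum_rel_entropy_def trace_sub XlnU
    by (subst X) (simp add: herm_fun_eq[OF V] tr[OF V])
  also have "\<dots> = (\<Sum>a\<in>UNIV. x a * ln (x a))
      - (\<Sum>a\<in>UNIV. \<Sum>b\<in>UNIV. (cmod (P $ a $ b))\<^sup>2 * (x a * ln (y b))) - (\<Sum>a\<in>UNIV. x a) + (\<Sum>b\<in>UNIV. y b)"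
    using sums by simp
  also have "\<dots> = (\<Sum>a\<in>UNIV. \<Sum>b\<in>UNIV. (cmod (P $ a $ b))\<^sup>2 * kl (x a) (y b))"
    unfolding row[of "\<lambda>a. x a * ln (x a)"] row[of x] col[of y] sum.distrib[symmetric] sum_subtractf[symmetric]
    by (intro sum.cong refl) (simp add: kl_def algebra_simps)
  finally show ?thesis .
qed

lemma quantum_rel_entropy_ge_diagonal_kl_eigenbases:
  assumes "trace X = trace U"
  shows "(\<Sum>i\<in>UNIV. kl (Re (X $ i $ i)) (Re (U $ i $ i))) \<le> quantum_rel_entropy X U"
  using kl_pinching quantum_rel_entropy_in_eigenbases[OF assms] by simp

end

section \<open>The spectraplex and tangent gradients\<close>

definition diag_vec :: "complex^'n^'n \<Rightarrow> real^'n" where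
  "diag_vec X = (\<chi> i. Re (X $ i $ i))"

lemma psd_mat_iff_hdot: "psd_mat A \<longleftrightarrow> hermitian_mat A \<and> (\<forall>x. 0 \<le> Re (hdot x (A *v x)))"
  by (simp add: psd_mat_def hdot_def)

lemma matrix_lincomb_mult_vec:
  "((s *\<^sub>R A + t *\<^sub>R B) :: complex^'n^'m) *v x = s *\<^sub>R (A *v x) + t *\<^sub>R (B *v x)"
  by (simp add: vec_eq_iff matrix_vector_mult_def sum.distrib scaleR_sum_right algebra_simps)

lemma hermitian_lincomb:
  "hermitian_mat A \<Longrightarrow> hermitian_mat B \<Longrightarrow> hermitian_mat (s *\<^sub>R A + t *\<^sub>R B)"
  by (simp add: hermitian_mat_def adj_mat_def vec_eq_iff)

lemma trace_lincomb: "trace (s *\<^sub>R A + t *\<^sub>R (B :: complex^'n^'n)) = s *\<^sub>R trace A + t *\<^sub>R trace B"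
  by (simp add: trace_def sum.distrib scaleR_sum_right)

lemma hdot_lincomb:
  "hdot x ((s *\<^sub>R A + t *\<^sub>R B) *v x) = s *\<^sub>R hdot x (A *v x) + t *\<^sub>R hdot x (B *v x)"
  by (simp add: matrix_lincomb_mult_vec hdot_right)

lemma convex_Spectraplex: "convex (Spectraplex :: (complex^'n^'n) set)"
  unfolding convex_def
proof (intro ballI allI impI)
  fix X Y :: "complex^'n^'n" and s t :: real
  assume "X \<in> Spectraplex" "Y \<in> Spectraplex" "0 \<le> s" "0 \<le> t" "s + t = 1"
  then show "s *\<^sub>R X + t *\<^sub>R Y \<in> Spectraplex"
    by (simp add: Spectraplex_def psd_mat_iff_hdot hermitian_lincomb trace_lincomb hdot_lincomb
        scaleR_left_distrib[symmetric])
qed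

lemma hermitian_diag_mat: "hermitian_mat (diag_mat l)"
  by (simp add: hermitian_mat_def adj_diag_mat)

lemma trace_diag_mat: "trace (diag_mat l) = complex_of_real (\<Sum>i\<in>UNIV. l i)"
  by (simp add: trace_def diag_mat_def)

lemma hdot_diag_mat: "hdot x (diag_mat l *v x) = complex_of_real (\<Sum>i\<in>UNIV. l i * (cmod (x $ i))\<^sup>2)"
proof -
  have "(diag_mat l *v x) $ i = complex_of_real (l i) * x $ i" for i
    by (simp add: diag_mat_def matrix_vector_mult_def if_distrib[where f = "\<lambda>c. c * _"] cong: if_cong)
  then show ?thesis by (simp add: hdot_def cmod_square mult_ac)
qed

lemma diag_mat_in_Spectraplex:
  assumes "\<And>i. 0 \<le> l i" "(\<Sum>i\<in>UNIV. l i) = 1"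
  shows "diag_mat l \<in> Spectraplex"
  using assms
  by (simp add: Spectraplex_def psd_mat_iff_hdot hermitian_diag_mat trace_diag_mat hdot_diag_mat sum_nonneg)

lemma hdot_axis: "hdot (axis i 1) (A *v axis i 1) = A $ i $ i"
  by (simp add: hdot_def axis_def matrix_vector_mult_def if_distrib[where f = cnj]
      if_distrib[where f = "\<lambda>c. c * _"] if_distrib[where f = "\<lambda>c. _ * c"] cong: if_cong)

lemma diag_vec_nonneg: "X \<in> Spectraplex \<Longrightarrow> 0 \<le> diag_vec X $ i"
  using hdot_axis[of i X] by (simp add: Spectraplex_def psd_mat_iff_hdot diag_vec_def) metis

lemma sum_diag_vec: "X \<in> Spectraplex \<Longrightarrow> (\<Sum>i\<in>UNIV. diag_vec X $ i) = 1"
  by (simp add: Spectraplex_def trace_def diag_vec_def Re_sum[symmetric] del: Re_sum)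

text \<open>A point of the relative interior can be moved a little away from the normalised identity
  without leaving the spectraplex, so it dominates a positive multiple of the identity.\<close>

lemma rel_interior_Spectraplex_definite:
  fixes U :: "complex^'n^'n"
  assumes "U \<in> rel_interior Spectraplex"
  obtains c where "0 < c" "\<And>x. c * (norm x)\<^sup>2 \<le> Re (hdot x (U *v x))"
proof -
  define J :: "complex^'n^'n" where "J = diag_mat (\<lambda>i. 1 / real CARD('n))"
  have J: "J \<in> Spectraplex" unfolding J_def by (rule diag_mat_in_Spectraplex) auto
  then obtain e where e: "1 < e" "(1 - e) *\<^sub>R J + e *\<^sub>R U \<in> Spectraplex"
    using assms convex_rel_interior_iff[OF convex_Spectraplex, of U] by blast
  have Jx: "Re (hdot x (J *v x)) = (norm x)\<^sup>2 / real CARD('n)" for x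
    by (simp add: J_def hdot_diag_mat sum_divide_distrib[symmetric] norm_vec_def L2_set_def sum_nonneg)
  have "(1 - 1 / e) / real CARD('n) * (norm x)\<^sup>2 \<le> Re (hdot x (U *v x))" for x
  proof -
    have "0 \<le> (1 - e) * Re (hdot x (J *v x)) + e * Re (hdot x (U *v x))"
      using e(2) by (simp add: Spectraplex_def psd_mat_iff_hdot hdot_lincomb)
    then have "(e - 1) / real CARD('n) * (norm x)\<^sup>2 \<le> e * Re (hdot x (U *v x))"
      by (simp add: Jx algebra_simps diff_divide_distrib)
    then have "(e - 1) / real CARD('n) * (norm x)\<^sup>2 / e \<le> Re (hdot x (U *v x))"
      using e(1) by (simp add: pos_divide_le_eq mult_ac)
    moreover have "(e - 1) / real CARD('n) * (norm x)\<^sup>2 / e = (1 - 1 / e) / real CARD('n) * (norm x)\<^sup>2"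
      using e(1) by (simp add: field_simps)
    ultimately show ?thesis by simp
  qed
  moreover have "0 < (1 - 1 / e) / real CARD('n)" using e(1) by simp
  ultimately show ?thesis using that by blast
qed

lemma rel_interior_Spectraplex_subset: "U \<in> rel_interior Spectraplex \<Longrightarrow> U \<in> Spectraplex"
  using rel_interior_subset by blast

lemma diag_vec_pos:
  assumes "U \<in> rel_interior Spectraplex"
  shows "0 < diag_vec U $ i"
proof -
  obtain c where c: "0 < c" "\<And>x. c * (norm x)\<^sup>2 \<le> Re (hdot x (U *v x))"
    using rel_interior_Spectraplex_definite[OF assms] by blast
  have "c \<le> diag_vec U $ i" using c(2)[of "axis i 1"] by (simp add: hdot_axis diag_vec_def)
  with c(1) show ?thesis by simp
qed

text \<open>Monotonicity of the quantum relative entropy under the pinching that erases all off-diagonal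
  entries.\<close>

theorem quantum_rel_entropy_ge_diagonal_kl:
  assumes X: "X \<in> Spectraplex" and U: "U \<in> rel_interior Spectraplex"
  shows "(\<Sum>i\<in>UNIV. kl (diag_vec X $ i) (diag_vec U $ i)) \<le> quantum_rel_entropy X U"
proof -
  have US: "U \<in> Spectraplex" using U by (rule rel_interior_Spectraplex_subset)
  obtain V x where V: "unitary_mat V" "X = V ** diag_mat x ** adj_mat V"
    using X hermitian_diagonalisation unfolding Spectraplex_def psd_mat_def by blast
  obtain W y where W: "unitary_mat W" "U = W ** diag_mat y ** adj_mat W"
    using US hermitian_diagonalisation unfolding Spectraplex_def psd_mat_def by blast
  have x: "0 \<le> x a" for a
  proof -
    obtain z where "hdot z (X *v z) = complex_of_real (x a)"
      using eigenvalue_as_quadratic_form[OF V] by metis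
    then show ?thesis using X unfolding Spectraplex_def psd_mat_iff_hdot
      by (metis (lifting) Re_complex_of_real mem_Collect_eq)
  qed
  obtain c where c: "0 < c" "\<And>z. c * (norm z)\<^sup>2 \<le> Re (hdot z (U *v z))"
    using rel_interior_Spectraplex_definite[OF U] by blast
  have y: "0 < y b" for b
  proof -
    obtain z where "norm z = 1" "hdot z (U *v z) = complex_of_real (y b)"
      using eigenvalue_as_quadratic_form[OF W] by metis
    then show ?thesis using c(1) c(2)[of z] by simp
  qed
  have "trace X = trace U" using X US by (simp add: Spectraplex_def)
  from quantum_rel_entropy_ge_diagonal_kl_eigenbases[OF V W x y this] show ?thesis
    by (simp add: diag_vec_def)
qed

lemma linear_herm_inner: "linear (herm_inner (G :: complex^'n^'n))"
proof (rule linearI)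
  show "herm_inner G (X + Y) = herm_inner G X + herm_inner G Y" for X Y
    by (simp add: herm_inner_def matrix_add_ldistrib trace_add)
  show "herm_inner G (c *\<^sub>R X) = c *\<^sub>R herm_inner G X" for c X
    by (simp add: herm_inner_def trace_def matrix_matrix_mult_def sum_distrib_left)
qed

lemma herm_inner_diag_mat:
  "herm_inner (diag_mat q) X = (\<Sum>i\<in>UNIV. q i * diag_vec X $ i)"
  by (simp add: herm_inner_def trace_def diag_mat_mult_left diag_vec_def)

lemma herm_inner_self:
  assumes "hermitian_mat H"
  shows "herm_inner H H = (norm H)\<^sup>2"
proof -
  have "trace (H ** H) = trace (H ** adj_mat H)" using assms by (simp add: hermitian_mat_def)
  also have "\<dots> = (\<Sum>a\<in>UNIV. \<Sum>b\<in>UNIV. complex_of_real ((cmod (H $ a $ b))\<^sup>2))"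
    by (simp add: trace_mult_adj_mat cmod_square)
  finally show ?thesis
    by (simp add: herm_inner_def norm_vec_def L2_set_def sum_nonneg)
qed

text \<open>Positive definiteness survives a small perturbation by any Hermitian matrix.\<close>

lemma rel_interior_Spectraplex_segment:
  fixes U H :: "complex^'n^'n"
  assumes U: "U \<in> rel_interior Spectraplex" and H: "H \<in> traceless_herm"
  obtains e where "0 < e" "\<And>t. \<bar>t\<bar> \<le> e \<Longrightarrow> U + t *\<^sub>R H \<in> Spectraplex"
proof -
  obtain c where c: "0 < c" "\<And>x. c * (norm x)\<^sup>2 \<le> Re (hdot x (U *v x))"
    using rel_interior_Spectraplex_definite[OF U] by blast
  have US: "U \<in> Spectraplex" using U by (rule rel_interior_Spectraplex_subset)
  have "linear (\<lambda>x. H *v x)"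
    by (rule linearI) (simp_all add: matrix_vector_right_distrib matrix_vector_scaleR)
  then obtain K where K: "0 < K" "\<And>x. norm (H *v x) \<le> K * norm x"
    using linear_bounded_pos by metis
  have Hx: "\<bar>Re (hdot x (H *v x))\<bar> \<le> K * (norm x)\<^sup>2" for x
  proof -
    have "\<bar>Re (hdot x (H *v x))\<bar> \<le> norm x * norm (H *v x)"
      unfolding inner_eq_Re_hdot[symmetric] by (rule Cauchy_Schwarz_ineq2)
    also have "\<dots> \<le> norm x * (K * norm x)" by (intro mult_left_mono K) simp
    finally show ?thesis by (simp add: power2_eq_square algebra_simps)
  qed
  have "U + t *\<^sub>R H \<in> Spectraplex" if t: "\<bar>t\<bar> \<le> c / K" for t
  proof -
    have eq: "U + t *\<^sub>R H = 1 *\<^sub>R U + t *\<^sub>R H" by simp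
    have "0 \<le> Re (hdot x (U *v x)) + t * Re (hdot x (H *v x))" for x
    proof -
      have "\<bar>t * Re (hdot x (H *v x))\<bar> \<le> c / K * (K * (norm x)\<^sup>2)"
        unfolding abs_mult using t K c(1) by (intro mult_mono Hx) auto
      also have "\<dots> = c * (norm x)\<^sup>2" using K by simp
      finally show ?thesis using c(2)[of x] by linarith
    qed
    moreover have "hermitian_mat (1 *\<^sub>R U + t *\<^sub>R H)" "trace (1 *\<^sub>R U + t *\<^sub>R H) = 1"
      unfolding trace_lincomb using US H hermitian_lincomb[of U H 1 t]
      by (simp_all add: Spectraplex_def psd_mat_def traceless_herm_def)
    ultimately show ?thesis
      unfolding eq Spectraplex_def psd_mat_iff_hdot hdot_lincomb mem_Collect_eq by auto
  qed
  moreover have "0 < c / K" using c K by simp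
  ultimately show ?thesis using that by blast
qed

text \<open>Write \<open>H\<close> for the difference of two tangent gradients. The line through \<open>U\<close> in direction \<open>H\<close>
  stays in the spectraplex for a short time in both directions, and \<open>F\<close> has only one derivative
  along it. So both gradients have the same inner product with \<open>H\<close>.\<close>

lemma has_tangent_gradient_unique:
  assumes U: "U \<in> rel_interior Spectraplex"
    and G: "has_tangent_gradient F G U" "has_tangent_gradient F G' U"
  shows "G' = G"
proof -
  define H where "H = G - G'"
  have GG: "hermitian_mat G" "hermitian_mat G'" "trace G = 0" "trace G' = 0"
    using G by (auto simp: has_tangent_gradient_def traceless_herm_def)
  have eq: "H = 1 *\<^sub>R G + (-1) *\<^sub>R G'" by (simp add: H_def)
  have hH: "hermitian_mat H" unfolding eq using GG by (intro hermitian_lincomb)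
  have H: "H \<in> traceless_herm"
    using hH GG by (simp add: traceless_herm_def H_def trace_sub)
  obtain e where e: "0 < e" "\<And>t. \<bar>t\<bar> \<le> e \<Longrightarrow> U + t *\<^sub>R H \<in> Spectraplex"
    using rel_interior_Spectraplex_segment[OF U H] by blast
  have d: "((\<lambda>t. F (U + t *\<^sub>R H)) has_field_derivative herm_inner g H) (at 0)"
    if g: "has_tangent_gradient F g U" for g
  proof -
    let ?I = "{- e<..<e}"
    have line: "((\<lambda>t. U + t *\<^sub>R H) has_derivative (\<lambda>t. t *\<^sub>R H)) (at 0 within ?I)"
      by (auto intro!: derivative_eq_intros)
    have "(F has_derivative herm_inner g) (at (U + 0 *\<^sub>R H) within ((\<lambda>t. U + t *\<^sub>R H) ` ?I))"
      using g e(2) by (auto simp: has_tangent_gradient_def intro!: has_derivative_subset[of F _ U Spectraplex])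
    from has_derivative_in_compose[OF line this]
    have "((\<lambda>t. F (U + t *\<^sub>R H)) has_derivative (\<lambda>t. herm_inner g (t *\<^sub>R H))) (at 0 within ?I)" .
    moreover have "at 0 within ?I = at (0::real)" using e(1) by (intro at_within_open) auto
    moreover have "(\<lambda>t. herm_inner g (t *\<^sub>R H)) = (*) (herm_inner g H)"
      using linear_scale[OF linear_herm_inner[of g]] by (auto simp: mult.commute)
    ultimately show ?thesis by (simp add: has_field_derivative_def)
  qed
  have "herm_inner G H = herm_inner G' H" using DERIV_unique[OF d[OF G(1)] d[OF G(2)]] .
  moreover have "herm_inner H H = herm_inner G H - herm_inner G' H"
    by (subst (1) H_def) (simp add: herm_inner_def trace_def matrix_matrix_mult_def left_diff_distrib sum_subtractf)
  ultimately have "(norm H)\<^sup>2 = 0" using herm_inner_self[OF hH] by simp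
  then show ?thesis by (simp add: H_def)
qed

lemma tangent_gradient_eq:
  assumes "U \<in> rel_interior Spectraplex" "has_tangent_gradient F G U"
  shows "tangent_gradient F U = G"
  unfolding tangent_gradient_def
  using assms has_tangent_gradient_unique by (intro the_equality) blast+

lemma has_derivative_within_quadratic:
  fixes f :: "'a::real_normed_vector \<Rightarrow> real"
  assumes "bounded_linear f'"
    and "\<And>y. y \<in> S \<Longrightarrow> \<bar>f y - f x - f' (y - x)\<bar> \<le> C * (norm (y - x))\<^sup>2"
  shows "(f has_derivative f') (at x within S)"
  unfolding has_derivative_within
proof (intro conjI assms(1))
  have "((\<lambda>y. C * norm (y - x)) \<longlongrightarrow> C * norm (x - x)) (at x within S)"
    by (intro tendsto_intros)
  then have lim: "((\<lambda>y. C * norm (y - x)) \<longlongrightarrow> 0) (at x within S)" by simp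
  have "norm ((1 / norm (y - x)) *\<^sub>R (f y - (f x + f' (y - x)))) \<le> C * norm (y - x)"
    if "y \<noteq> x" "y \<in> S" for y
  proof -
    have "norm ((1 / norm (y - x)) *\<^sub>R (f y - (f x + f' (y - x))))
        = \<bar>f y - f x - f' (y - x)\<bar> / norm (y - x)" by (simp add: diff_diff_eq)
    also have "\<dots> \<le> C * (norm (y - x))\<^sup>2 / norm (y - x)"
      using assms(2)[OF that(2)] by (intro divide_right_mono) auto
    also have "\<dots> = C * norm (y - x)" using that by (simp add: power2_eq_square)
    finally show ?thesis .
  qed
  then show "((\<lambda>y. (1 / norm (y - x)) *\<^sub>R (f y - (f x + f' (y - x)))) \<longlongrightarrow> 0) (at x within S)"
    by (intro Lim_null_comparison[OF _ lim]) (simp add: eventually_at_filter)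
qed

section \<open>Relatively smooth functions of the diagonal\<close>

definition hard_fun :: "real \<Rightarrow> ('n::finite \<Rightarrow> real option) \<Rightarrow> complex^'n^'n \<Rightarrow> real" where
  "hard_fun L b X = L * smooth_max b (diag_vec X)"

text \<open>The mean is subtracted in order to make the matrix traceless.\<close>

definition hard_grad :: "real \<Rightarrow> ('n::finite \<Rightarrow> real option) \<Rightarrow> complex^'n^'n \<Rightarrow> complex^'n^'n" where
  "hard_grad L b U = (let p = (\<lambda>i. L * ln (1 - optimal_weights b (diag_vec U) $ i / 2))
     in diag_mat (\<lambda>i. p i - (\<Sum>j\<in>UNIV. p j) / real CARD('n)))"

lemma hard_grad_traceless: "hard_grad L b U \<in> traceless_herm"
  by (simp add: hard_grad_def Let_def traceless_herm_def hermitian_diag_mat trace_diag_mat sum_subtractf)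

lemma herm_inner_hard_grad:
  assumes "X \<in> Spectraplex" "U \<in> Spectraplex"
  shows "herm_inner (hard_grad L b U') (X - U)
    = L * (\<Sum>i\<in>UNIV. ln (1 - optimal_weights b (diag_vec U') $ i / 2) * (diag_vec X $ i - diag_vec U $ i))"
proof -
  have d: "diag_vec (X - U) $ i = diag_vec X $ i - diag_vec U $ i" for i by (simp add: diag_vec_def)
  have "(\<Sum>i\<in>UNIV. (p i - m) * (diag_vec X $ i - diag_vec U $ i))
      = (\<Sum>i\<in>UNIV. p i * (diag_vec X $ i - diag_vec U $ i))" for p m
    unfolding left_diff_distrib[where c = "diag_vec X $ _ - diag_vec U $ _"] sum_subtractf sum_distrib_left[symmetric]
    using sum_diag_vec[OF assms(1)] sum_diag_vec[OF assms(2)] by simp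
  then show ?thesis
    unfolding hard_grad_def Let_def herm_inner_diag_mat d by (simp add: sum_distrib_left mult.assoc)
qed

lemma hard_fun_bounds:
  assumes b: "dom b \<noteq> {}" and L: "0 \<le> L"
    and X: "X \<in> Spectraplex" and U: "U \<in> rel_interior Spectraplex"
  shows "0 \<le> hard_fun L b X - hard_fun L b U - herm_inner (hard_grad L b U) (X - U)"
    and "hard_fun L b X - hard_fun L b U - herm_inner (hard_grad L b U) (X - U)
      \<le> L * (\<Sum>i\<in>UNIV. kl (diag_vec X $ i) (diag_vec U $ i))"
proof -
  have US: "U \<in> Spectraplex" using U by (rule rel_interior_Spectraplex_subset)
  let ?w = "optimal_weights b (diag_vec U)"
  let ?R = "smooth_max b (diag_vec X) - smooth_max b (diag_vec U)
    - (\<Sum>i\<in>UNIV. ln (1 - ?w $ i / 2) * (diag_vec X $ i - diag_vec U $ i))"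
  have o: "optimal b (diag_vec U) ?w" using b by (rule optimal_optimal_weights)
  have eq: "hard_fun L b X - hard_fun L b U - herm_inner (hard_grad L b U) (X - U) = L * ?R"
    by (simp add: hard_fun_def herm_inner_hard_grad[OF X US] right_diff_distrib)
  have "0 \<le> ?R" using smooth_max_above_tangent[OF o diag_vec_nonneg[OF US], of "diag_vec X"] by simp
  then show "0 \<le> hard_fun L b X - hard_fun L b U - herm_inner (hard_grad L b U) (X - U)"
    unfolding eq using L by simp
  have "?R \<le> (\<Sum>i\<in>UNIV. kl (diag_vec X $ i) (diag_vec U $ i))"
    using smooth_max_below_kl[OF o diag_vec_pos[OF U] diag_vec_nonneg[OF X]] by simp
  then show "hard_fun L b X - hard_fun L b U - herm_inner (hard_grad L b U) (X - U)
      \<le> L * (\<Sum>i\<in>UNIV. kl (diag_vec X $ i) (diag_vec U $ i))"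
    unfolding eq using L by (intro mult_left_mono)
qed

lemma hard_fun_has_tangent_gradient:
  fixes b :: "'n::finite \<Rightarrow> real option"
  assumes b: "dom b \<noteq> {}" and L: "0 \<le> L" and U: "U \<in> rel_interior Spectraplex"
  shows "has_tangent_gradient (hard_fun L b) (hard_grad L b U) U"
  unfolding has_tangent_gradient_def
proof (intro conjI hard_grad_traceless has_derivative_within_quadratic)
  show "bounded_linear (herm_inner (hard_grad L b U))"
    using linear_herm_inner linear_conv_bounded_linear by blast
  let ?u = "diag_vec U"
  fix X :: "complex^'n^'n" assume X: "X \<in> Spectraplex"
  have "(\<Sum>i\<in>UNIV. kl (diag_vec X $ i) (?u $ i)) \<le> (\<Sum>i\<in>UNIV. (norm (X - U))\<^sup>2 / ?u $ i)"
  proof (rule sum_mono)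
    fix i
    have "\<bar>diag_vec X $ i - ?u $ i\<bar> = \<bar>Re ((X - U) $ i $ i)\<bar>" by (simp add: diag_vec_def)
    also have "\<dots> \<le> cmod ((X - U) $ i $ i)" by (rule abs_Re_le_cmod)
    also have "\<dots> \<le> norm (X - U)"
      using Finite_Cartesian_Product.norm_nth_le[of "(X - U) $ i" i]
        Finite_Cartesian_Product.norm_nth_le[of "X - U" i] by linarith
    finally have "(diag_vec X $ i - ?u $ i)\<^sup>2 \<le> (norm (X - U))\<^sup>2" by (simp add: abs_le_square_iff[symmetric])
    then have "(diag_vec X $ i - ?u $ i)\<^sup>2 / ?u $ i \<le> (norm (X - U))\<^sup>2 / ?u $ i"
      using diag_vec_pos[OF U, of i] by (intro divide_right_mono) auto
    then show "kl (diag_vec X $ i) (?u $ i) \<le> (norm (X - U))\<^sup>2 / ?u $ i"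
      using kl_le_chi_square[OF diag_vec_nonneg[OF X] diag_vec_pos[OF U], of i i] by linarith
  qed
  then have "L * (\<Sum>i\<in>UNIV. kl (diag_vec X $ i) (?u $ i)) \<le> L * (\<Sum>i\<in>UNIV. (norm (X - U))\<^sup>2 / ?u $ i)"
    using L by (rule mult_left_mono)
  also have "\<dots> = (L * (\<Sum>i\<in>UNIV. 1 / ?u $ i)) * (norm (X - U))\<^sup>2"
    by (simp add: sum_distrib_left sum_distrib_right mult_ac)
  finally show "\<bar>hard_fun L b X - hard_fun L b U - herm_inner (hard_grad L b U) (X - U)\<bar>
      \<le> (L * (\<Sum>i\<in>UNIV. 1 / ?u $ i)) * (norm (X - U))\<^sup>2"
    using hard_fun_bounds[OF b L X U] by linarith
qed

lemma tangent_gradient_hard_fun: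
  assumes "dom b \<noteq> {}" "0 \<le> L" "U \<in> rel_interior Spectraplex"
  shows "tangent_gradient (hard_fun L b) U = hard_grad L b U"
  using assms by (intro tangent_gradient_eq hard_fun_has_tangent_gradient)

lemma continuous_on_hard_grad:
  fixes b :: "'n::finite \<Rightarrow> real option"
  assumes b: "dom b \<noteq> {}"
  shows "continuous_on (rel_interior Spectraplex) (hard_grad L b)"
proof -
  have "continuous_on (rel_interior Spectraplex) (\<lambda>U :: complex^'n^'n. diag_vec U)"
    unfolding diag_vec_def by (intro continuous_intros)
  then have optimal_weights: "continuous_on (rel_interior Spectraplex) (\<lambda>U. optimal_weights b (diag_vec U))"
    by (rule continuous_on_compose2[OF continuous_on_optimal_weights[OF b]]) (auto simp: diag_vec_pos)
  have ln: "continuous_on (rel_interior Spectraplex) (\<lambda>U. ln (1 - optimal_weights b (diag_vec U) $ i / 2))" for i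
  proof (intro continuous_on_ln continuous_intros optimal_weights ballI)
    fix U :: "complex^'n^'n"
    have "optimal_weights b (diag_vec U) \<in> weights b" using optimal_optimal_weights[OF b] by (simp add: optimal_def)
    then show "1 - optimal_weights b (diag_vec U) $ i / 2 \<noteq> 0" using weights_bounds(2)[of _ b i] by fastforce
  qed simp_all
  have "continuous_on (rel_interior Spectraplex)
      (\<lambda>U. complex_of_real (L * c U i - (\<Sum>j\<in>UNIV. L * c U j) / real CARD('n)))"
    if "\<And>i. continuous_on (rel_interior Spectraplex) (\<lambda>U. c U i)" for c and i :: 'n
    by (intro continuous_intros that) simp
  from this[of "\<lambda>U i. ln (1 - optimal_weights b (diag_vec U) $ i / 2)", OF ln]
  have entry: "continuous_on (rel_interior Spectraplex) (\<lambda>U. hard_grad L b U $ i $ j)" for i j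
    unfolding hard_grad_def Let_def diag_mat_def by (cases "i = j") simp_all
  have "continuous_on (rel_interior Spectraplex) (\<lambda>U. \<chi> i j. hard_grad L b U $ i $ j)"
    by (intro continuous_intros entry)
  then show ?thesis by simp
qed

text \<open>The relative smoothness of \<open>smooth_max\<close> gives the upper bound with the relative entropy of
  the diagonals, and pinching bounds the latter by the quantum relative entropy.\<close>

theorem hard_fun_in_Ent:
  assumes b: "dom b \<noteq> {}" and L: "0 \<le> L"
  shows "hard_fun L b \<in> Ent L"
proof -
  note tg = tangent_gradient_hard_fun[OF b L]
  have "convex_on Spectraplex (hard_fun L b)"
  proof (rule convex_onI)
    fix t :: real and X Y :: "complex^'a^'a"
    assume t: "0 < t" "t < 1"
    have "diag_vec ((1 - t) *\<^sub>R X + t *\<^sub>R Y) = (1 - t) *\<^sub>R diag_vec X + t *\<^sub>R diag_vec Y"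
      by (simp add: diag_vec_def vec_eq_iff)
    then have "smooth_max b (diag_vec ((1 - t) *\<^sub>R X + t *\<^sub>R Y))
        \<le> (1 - t) * smooth_max b (diag_vec X) + t * smooth_max b (diag_vec Y)"
      using smooth_max_convex[OF b, of "1 - t" t] t by simp
    from mult_left_mono[OF this L]
    show "hard_fun L b ((1 - t) *\<^sub>R X + t *\<^sub>R Y) \<le> (1 - t) * hard_fun L b X + t * hard_fun L b Y"
      by (simp add: hard_fun_def algebra_simps)
  qed (rule convex_Spectraplex)
  moreover have "continuous_on (rel_interior Spectraplex) (tangent_gradient (hard_fun L b))"
    using continuous_on_hard_grad[OF b] tg by (simp cong: continuous_on_cong)
  moreover have "hard_fun L b X - hard_fun L b U - herm_inner (hard_grad L b U) (X - U)
      \<le> L * quantum_rel_entropy X U"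
    if X: "X \<in> Spectraplex" and U: "U \<in> rel_interior Spectraplex" for X U
    using hard_fun_bounds(2)[OF b L X U] mult_left_mono[OF quantum_rel_entropy_ge_diagonal_kl[OF X U] L]
    by linarith
  ultimately show ?thesis
    using hard_fun_has_tangent_gradient[OF b L] hard_fun_bounds(1)[OF b L]
    unfolding Ent_def by (auto simp: tg)
qed

text \<open>The function depends on the diagonal only, so a minimiser over the probability simplex,
  written as a diagonal matrix, is a minimiser over the spectraplex. The simplex is the set of
  weights of any total map.\<close>

lemma hard_fun_has_min:
  fixes b :: "'n::finite \<Rightarrow> real option"
  assumes b: "dom b \<noteq> {}" and L: "0 \<le> L"
  obtains Xmin where "is_arg_min (hard_fun L b) (\<lambda>X. X \<in> Spectraplex) Xmin"
proof -
  define S :: "(real^'n) set" where "S = weights (\<lambda>_. Some 0)"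
  have "S \<noteq> {}" using axis_in_weights[of _ "\<lambda>_. Some 0"] by (auto simp: S_def)
  then obtain x where x: "x \<in> S" "\<And>y. y \<in> S \<Longrightarrow> smooth_max b x \<le> smooth_max b y"
    using continuous_attains_inf[OF compact_weights _ continuous_on_smooth_max[OF b]]
    unfolding S_def by metis
  let ?X = "diag_mat (\<lambda>i. x $ i) :: complex^'n^'n"
  have "diag_vec ?X = x" by (simp add: diag_vec_def diag_mat_def vec_eq_iff)
  moreover have "?X \<in> Spectraplex"
    using x(1) by (intro diag_mat_in_Spectraplex) (auto simp: S_def weights_def)
  moreover have "smooth_max b x \<le> smooth_max b (diag_vec Y)" if "Y \<in> Spectraplex" for Y
    using that by (intro x(2)) (simp add: S_def weights_def diag_vec_nonneg sum_diag_vec)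
  ultimately have "is_arg_min (hard_fun L b) (\<lambda>X. X \<in> Spectraplex) ?X"
    unfolding is_arg_min_linorder hard_fun_def using L by (auto intro!: mult_left_mono)
  then show ?thesis using that by blast
qed

section \<open>The resisting oracle\<close>

text \<open>Otherwise the coordinates outside \<open>J\<close> alone would sum to more than \<open>1\<close>.\<close>

lemma small_fresh_coordinate:
  fixes x :: "real^'n"
  assumes "\<And>i. 0 \<le> x $ i" "(\<Sum>i\<in>UNIV. x $ i) = 1" "1 \<le> eps * (real CARD('n) - real (card J))"
  obtains i where "i \<notin> J" "x $ i \<le> eps"
proof -
  have "\<exists>i. i \<notin> J \<and> x $ i \<le> eps"
  proof (rule ccontr)
    assume "\<not> ?thesis"
    then have big: "eps < x $ i" if "i \<in> - J" for i using that by (meson ComplD not_le)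
    have card: "real (card (- J)) = real CARD('n) - real (card J)"
      by (simp add: Compl_eq_Diff_UNIV card_Diff_subset of_nat_diff card_mono)
    then have "- J \<noteq> {}" using assms(3) by auto
    then have "(\<Sum>i\<in>- J. eps) < (\<Sum>i\<in>- J. x $ i)" using big by (intro sum_strict_mono) auto
    also have "\<dots> \<le> (\<Sum>i\<in>UNIV. x $ i)" using assms(1) by (intro sum_mono2) auto
    finally show False using assms(2,3) by (simp add: card mult.commute)
  qed
  then show ?thesis using that by blast
qed

context
  fixes L eps :: real and T :: nat
    and \<Phi> :: "nat \<Rightarrow> 'n::finite answer list \<Rightarrow> complex^'n^'n"
    and \<Phi>out :: "'n answer list \<Rightarrow> complex^'n^'n"
  assumes L: "0 < L" and eps: "0 < eps" "1 \<le> eps * (real CARD('n) - real T)"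
    and valid: "deterministic_method T \<Phi> \<Phi>out"
begin

text \<open>The bonuses after \<open>t\<close> points have been seen, where the method is run against the function
  that the adversary has committed to so far. The first \<open>T\<close> points are queries and the point with
  number \<open>T\<close> (counting from \<open>0\<close>) is the returned one. The bonus decreases by \<open>eps\<close> in every step
  and ends with \<open>0\<close>.\<close>

primrec adversary :: "nat \<Rightarrow> 'n \<Rightarrow> real option" where
  "adversary 0 = Map.empty"
| "adversary (Suc t) =
    (let b = adversary t; h = answers \<Phi> (hard_fun L b) t; X = (if t < T then \<Phi> (Suc t) h else \<Phi>out h)
     in b((SOME i. i \<notin> dom b \<and> diag_vec X $ i \<le> eps) \<mapsto> eps * (real T - real t)))"

definition queried_point :: "nat \<Rightarrow> complex^'n^'n" where
  "queried_point t = (let h = answers \<Phi> (hard_fun L (adversary t)) t in if t < T then \<Phi> (Suc t) h else \<Phi>out h)"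

definition fresh :: "nat \<Rightarrow> 'n" where
  "fresh t = (SOME i. i \<notin> dom (adversary t) \<and> diag_vec (queried_point t) $ i \<le> eps)"

lemma adversary_Suc: "adversary (Suc t) = (adversary t)(fresh t \<mapsto> eps * (real T - real t))"
  by (simp add: Let_def fresh_def queried_point_def)

declare adversary.simps(2) [simp del]

lemma dom_adversary_Suc: "dom (adversary (Suc t)) = insert (fresh t) (dom (adversary t))"
  by (auto simp: adversary_Suc)

lemma adversary_fresh: "adversary (Suc t) (fresh t) = Some (eps * (real T - real t))"
  by (simp add: adversary_Suc)

lemma adversary_Suc_other: "k \<noteq> fresh t \<Longrightarrow> adversary (Suc t) k = adversary t k"
  by (simp add: adversary_Suc)

lemma query_in_rel_interior: "t < T \<Longrightarrow> h \<in> transcripts t \<Longrightarrow> \<Phi> (Suc t) h \<in> rel_interior Spectraplex"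
  using valid by (force simp: deterministic_method_def Pi_iff)

lemma answers_in_transcripts:
  assumes "dom b \<noteq> {}" "t \<le> T"
  shows "answers \<Phi> (hard_fun L b) t \<in> transcripts t"
  using assms(2)
proof (induction t)
  case 0
  show ?case by (simp add: transcripts_def)
next
  case (Suc t)
  then have h: "answers \<Phi> (hard_fun L b) t \<in> transcripts t" by simp
  have "\<Phi> (Suc t) (answers \<Phi> (hard_fun L b) t) \<in> rel_interior Spectraplex"
    using Suc.prems h by (intro query_in_rel_interior) auto
  then have "tangent_gradient (hard_fun L b) (\<Phi> (Suc t) (answers \<Phi> (hard_fun L b) t)) \<in> traceless_herm"
    using assms(1) L by (simp add: tangent_gradient_hard_fun hard_grad_traceless)
  then show ?case using h by (simp add: transcripts_def Let_def)
qed

lemma queried_point_in_Spectraplex: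
  assumes "t \<le> T" "t = 0 \<or> dom (adversary t) \<noteq> {}"
  shows "queried_point t \<in> Spectraplex" "t < T \<Longrightarrow> queried_point t \<in> rel_interior Spectraplex"
proof -
  have h: "answers \<Phi> (hard_fun L (adversary t)) t \<in> transcripts t"
    using assms answers_in_transcripts by (cases "t = 0") (auto simp: transcripts_def)
  then show r: "queried_point t \<in> rel_interior Spectraplex" if "t < T"
    using that by (simp add: queried_point_def Let_def query_in_rel_interior)
  show "queried_point t \<in> Spectraplex"
  proof (cases "t < T")
    case True
    then show ?thesis using r rel_interior_Spectraplex_subset by blast
  next
    case False
    then have "t = T" using assms(1) by simp
    then show ?thesis using h valid by (simp add: queried_point_def Let_def deterministic_method_def Pi_iff)
  qed
qed

lemma fresh_coordinate:
  assumes "t \<le> T" "t = 0 \<or> dom (adversary t) \<noteq> {}" "card (dom (adversary t)) = t"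
  shows "fresh t \<notin> dom (adversary t)" "diag_vec (queried_point t) $ fresh t \<le> eps"
proof -
  note P = queried_point_in_Spectraplex(1)[OF assms(1,2)]
  have "eps * (real CARD('n) - real T) \<le> eps * (real CARD('n) - real (card (dom (adversary t))))"
    using assms eps by (intro mult_left_mono) auto
  then have "1 \<le> eps * (real CARD('n) - real (card (dom (adversary t))))" using eps(2) by linarith
  then have "\<exists>i. i \<notin> dom (adversary t) \<and> diag_vec (queried_point t) $ i \<le> eps"
    using small_fresh_coordinate[OF diag_vec_nonneg[OF P] sum_diag_vec[OF P]] by metis
  from someI_ex[OF this] show "fresh t \<notin> dom (adversary t)" "diag_vec (queried_point t) $ fresh t \<le> eps"
    unfolding fresh_def by auto
qed

lemma card_adversary: "t \<le> Suc T \<Longrightarrow> card (dom (adversary t)) = t"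
proof (induction t)
  case (Suc t)
  then have c: "card (dom (adversary t)) = t" by simp
  then have "t = 0 \<or> dom (adversary t) \<noteq> {}" by auto
  then have "fresh t \<notin> dom (adversary t)" using fresh_coordinate(1)[OF _ _ c] Suc.prems by simp
  then show ?case using c by (simp add: dom_adversary_Suc)
qed simp

lemma adversary_nonempty: "0 < t \<Longrightarrow> t \<le> Suc T \<Longrightarrow> dom (adversary t) \<noteq> {}"
  using card_adversary[of t] by auto

lemma fresh_step:
  assumes "t \<le> T"
  shows "fresh t \<notin> dom (adversary t)" "diag_vec (queried_point t) $ fresh t \<le> eps" "queried_point t \<in> Spectraplex"
    "t < T \<Longrightarrow> queried_point t \<in> rel_interior Spectraplex"
proof -
  have c: "card (dom (adversary t)) = t" using card_adversary assms by simp
  have n: "t = 0 \<or> dom (adversary t) \<noteq> {}" using adversary_nonempty[of t] assms by auto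
  show "fresh t \<notin> dom (adversary t)" "diag_vec (queried_point t) $ fresh t \<le> eps"
    using fresh_coordinate[OF assms n c] by auto
  show "queried_point t \<in> Spectraplex" "t < T \<Longrightarrow> queried_point t \<in> rel_interior Spectraplex"
    using queried_point_in_Spectraplex[OF assms n] by auto
qed

lemma adversary_mono:
  assumes "s \<le> t" "t \<le> Suc T"
  shows "adversary s \<subseteq>\<^sub>m adversary t"
  using assms
proof (induction t rule: dec_induct)
  case (step t)
  have "fresh t \<notin> dom (adversary t)" using fresh_step(1)[of t] step.prems by simp
  then have "adversary t \<subseteq>\<^sub>m adversary (Suc t)"
    unfolding map_le_def using adversary_Suc_other by metis
  then show ?case using step by (meson Suc_leD map_le_trans)
qed simp

text \<open>Bonuses decrease with the time of assignment.\<close>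

lemma later_bonus_le:
  assumes "s \<le> t" "t \<le> Suc T" "k \<in> dom (adversary t) - dom (adversary s)"
  shows "the (adversary t k) \<le> eps * (real T - real s)"
  using assms
proof (induction t rule: dec_induct)
  case base
  then show ?case by simp
next
  case (step t)
  show ?case
  proof (cases "k = fresh t")
    case True
    then show ?thesis using eps step.hyps by (simp add: adversary_fresh mult_left_mono)
  next
    case False
    then show ?thesis using step by (simp add: adversary_Suc_other dom_adversary_Suc)
  qed
qed

text \<open>The queried point with number \<open>t\<close> has a coordinate \<open>fresh t\<close> of size at most \<open>eps\<close>, whose
  bonus exceeds all later ones by at least \<open>eps\<close>. By \<open>smooth_max_extend\<close> the later indices change
  neither the value nor the gradient there.\<close>

lemma answers_consistent:
  assumes "t \<le> m" "m \<le> Suc T" "t \<le> T"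
  shows "answers \<Phi> (hard_fun L (adversary m)) t = answers \<Phi> (hard_fun L (adversary t)) t"
  using assms
proof (induction t arbitrary: m)
  case 0
  show ?case by simp
next
  case (Suc t)
  let ?b = "adversary (Suc t)" and ?X = "queried_point t"
  have t: "t \<le> T" "t < T" using Suc.prems by auto
  have X: "?X = \<Phi> (Suc t) (answers \<Phi> (hard_fun L (adversary t)) t)"
    using t by (simp add: queried_point_def Let_def)
  have ri: "?X \<in> rel_interior Spectraplex" using fresh_step(4)[OF t] .
  have new: "the (adversary m k) + diag_vec ?X $ fresh t \<le> the (?b (fresh t))"
    if k: "k \<in> dom (adversary m) - dom ?b" for k
  proof -
    have "the (adversary m k) \<le> eps * (real T - real (Suc t))"
      using later_bonus_le[OF _ _ k] Suc.prems by simp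
    moreover have "the (?b (fresh t)) = eps * (real T - real t)" by (simp add: adversary_fresh)
    ultimately show ?thesis using fresh_step(2)[OF t(1)] by (simp add: algebra_simps)
  qed
  have "fresh t \<in> dom ?b" by (simp add: dom_adversary_Suc)
  then have extend: "smooth_max (adversary m) (diag_vec ?X) = smooth_max ?b (diag_vec ?X)"
      "optimal_weights (adversary m) (diag_vec ?X) = optimal_weights ?b (diag_vec ?X)"
    using smooth_max_extend[OF adversary_mono[OF Suc.prems(1,2)] _ diag_vec_pos[OF ri], of "fresh t"] new
    by blast+
  have same: "hard_fun L (adversary m) ?X = hard_fun L ?b ?X"
      "hard_grad L (adversary m) ?X = hard_grad L ?b ?X"
    by (simp_all add: hard_fun_def hard_grad_def extend)
  have "tangent_gradient (hard_fun L (adversary m)) ?X = tangent_gradient (hard_fun L ?b) ?X"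
    using tangent_gradient_hard_fun[OF adversary_nonempty _ ri] L Suc.prems same by simp
  moreover have "answers \<Phi> (hard_fun L (adversary m)) t = answers \<Phi> (hard_fun L (adversary t)) t"
      "answers \<Phi> (hard_fun L ?b) t = answers \<Phi> (hard_fun L (adversary t)) t"
    using Suc.IH[of m] Suc.IH[of "Suc t"] Suc.prems by auto
  ultimately show ?case by (simp add: Let_def X[symmetric] same)
qed

text \<open>Putting all weight on the last fresh coordinate, which has bonus \<open>0\<close> and size at most \<open>eps\<close>
  at the returned point, gives the payoff \<open>- x ln 2\<close> with \<open>x \<le> eps\<close>.\<close>

lemma returned_value:
  "- L * eps < hard_fun L (adversary (Suc T)) (returned_point T \<Phi> \<Phi>out (hard_fun L (adversary (Suc T))))"
proof -
  let ?b = "adversary (Suc T)"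
  have X: "returned_point T \<Phi> \<Phi>out (hard_fun L ?b) = queried_point T"
    unfolding returned_point_def queried_point_def using answers_consistent[of T "Suc T"] by (simp)
  let ?x = "diag_vec (queried_point T) $ fresh T" and ?e = "axis (fresh T) 1 :: real^'n"
  have x: "0 \<le> ?x" "?x \<le> eps" using fresh_step[of T] diag_vec_nonneg by auto
  have "payoff ?b ?e (diag_vec (queried_point T)) = the (?b (fresh T)) + ?x * ln (1 / 2)"
  proof -
    have "the (?b i) * ?e $ i + diag_vec (queried_point T) $ i * ln (1 - ?e $ i / 2)
        = (if i = fresh T then the (?b (fresh T)) + ?x * ln (1 / 2) else 0)" for i
      by (simp add: axis_def)
    then show ?thesis by (simp add: payoff_def)
  qed
  also have "the (?b (fresh T)) = 0" by (simp add: adversary_fresh)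
  finally have "- ?x * ln 2 \<le> smooth_max ?b (diag_vec (queried_point T))"
    using smooth_max_ge[OF axis_in_weights[of "fresh T" ?b], of "diag_vec (queried_point T)"]
    by (simp add: ln_div dom_adversary_Suc)
  moreover have "?x * ln 2 \<le> eps * ln 2" using x by (intro mult_right_mono) auto
  moreover have "eps * ln 2 < eps * 1" using eps ln_2_less_1 by (intro mult_strict_left_mono) auto
  ultimately have "- eps < smooth_max ?b (diag_vec (queried_point T))" by linarith
  from mult_strict_left_mono[OF this L] show ?thesis unfolding X hard_fun_def by simp
qed

text \<open>At the uniform distribution on the index set every payoff is at most the largest bonus
  \<open>eps * T\<close> minus \<open>(\<Sum>i. w\<^sub>i / 2) / N\<close>, by \<open>ln (1 - w / 2) \<le> - w / 2\<close>.\<close>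

lemma min_value:
  fixes N :: real
  defines "N \<equiv> real (Suc T)"
  shows "\<exists>X\<in>Spectraplex. hard_fun L (adversary (Suc T)) X \<le> L * (eps * real T - 1 / (2 * N))"
proof -
  let ?b = "adversary (Suc T)"
  define x where "x = (\<lambda>i. if i \<in> dom ?b then 1 / N else 0)"
  have N: "0 < N" by (simp add: N_def)
  have "(\<Sum>i\<in>UNIV. x i) = 1"
    using N card_adversary[of "Suc T"] by (simp add: x_def sum.If_cases N_def)
  then have "diag_mat x \<in> Spectraplex" using N by (intro diag_mat_in_Spectraplex) (auto simp: x_def)
  moreover have "smooth_max ?b (diag_vec (diag_mat x)) \<le> eps * real T - 1 / (2 * N)"
  proof -
    obtain w where w: "w \<in> weights ?b" "smooth_max ?b (diag_vec (diag_mat x)) = payoff ?b w (diag_vec (diag_mat x))"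
      using smooth_max_attained[OF adversary_nonempty[of "Suc T"]] by (metis le_refl zero_less_Suc)
    have d: "diag_vec (diag_mat x) $ i = x i" for i by (simp add: diag_vec_def diag_mat_def)
    have "the (?b i) * w $ i + x i * ln (1 - w $ i / 2) \<le> (eps * real T - 1 / (2 * N)) * w $ i" for i
    proof (cases "i \<in> dom ?b")
      case True
      have "the (?b i) * w $ i \<le> eps * real T * w $ i"
        using later_bonus_le[of 0 "Suc T" i] True weights_bounds(1)[OF w(1)]
        by (intro mult_right_mono) auto
      moreover have "x i * ln (1 - w $ i / 2) \<le> 1 / N * (- (w $ i / 2))"
      proof -
        have "1 / N * ln (1 - w $ i / 2) \<le> 1 / N * (- (w $ i / 2))"
          using ln_le_minus_one[of "1 - w $ i / 2"] weights_bounds(2)[OF w(1), of i] N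
          by (intro mult_left_mono) simp_all
        then show ?thesis using True by (simp add: x_def)
      qed
      ultimately show ?thesis by (simp add: left_diff_distrib)
    next
      case False
      then have "w $ i = 0" using w(1) by (auto simp: weights_def)
      then show ?thesis by simp
    qed
    then have "payoff ?b w (diag_vec (diag_mat x)) \<le> (\<Sum>i\<in>UNIV. (eps * real T - 1 / (2 * N)) * w $ i)"
      unfolding payoff_def d by (rule sum_mono)
    also have "\<dots> = eps * real T - 1 / (2 * N)"
      using w(1) by (simp add: sum_distrib_left[symmetric] weights_def)
    finally show ?thesis using w(2) by simp
  qed
  ultimately show ?thesis using L unfolding hard_fun_def by (intro bexI[of _ "diag_mat x"] mult_left_mono) auto
qed

end

theorem theorem11:
  fixes L :: real and T :: nat
    and \<Phi> :: "nat \<Rightarrow> 'n::finite answer list \<Rightarrow> complex^'n^'n"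
    and \<Phi>out :: "'n answer list \<Rightarrow> complex^'n^'n"
  assumes "L > 0" and "T \<ge> 1" and "CARD('n) \<ge> 8 * (T + 1)^2 + T"
    and "deterministic_method T \<Phi> \<Phi>out"
  shows "\<exists>F\<in>Ent L. \<exists>Xmin. is_arg_min F (\<lambda>X. X \<in> Spectraplex) Xmin \<and>
    F (returned_point T \<Phi> \<Phi>out F) - F Xmin > L / (4 * (real T + 1))"
proof -
  define N where "N = real T + 1"
  define eps where "eps = 1 / (8 * N\<^sup>2)"
  have N: "0 < N" by (simp add: N_def)
  have eps: "0 < eps" using N by (simp add: eps_def)
  have "real (8 * (T + 1)^2 + T) \<le> real CARD('n)" using assms(3) of_nat_le_iff by blast
  then have "8 * N\<^sup>2 \<le> real CARD('n) - real T" by (simp add: N_def add.commute)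
  then have "eps * (8 * N\<^sup>2) \<le> eps * (real CARD('n) - real T)" using eps by (intro mult_left_mono) auto
  then have big: "1 \<le> eps * (real CARD('n) - real T)" using N by (simp add: eps_def)
  define b where "b = adversary L eps T \<Phi> \<Phi>out (Suc T)"
  have b: "dom b \<noteq> {}"
    unfolding b_def using adversary_nonempty[OF assms(1) eps big assms(4)] by blast
  have F: "hard_fun L b \<in> Ent L" using hard_fun_in_Ent[OF b] assms(1) by simp
  obtain Xmin where Xmin: "is_arg_min (hard_fun L b) (\<lambda>X. X \<in> Spectraplex) Xmin"
    using hard_fun_has_min[OF b] assms(1) less_imp_le by metis
  obtain X where X: "X \<in> Spectraplex" "hard_fun L b X \<le> L * (eps * real T - 1 / (2 * N))"
    using min_value[OF assms(1) eps big assms(4)] unfolding b_def N_def by (auto simp: add.commute)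
  have "hard_fun L b Xmin \<le> L * (eps * real T - 1 / (2 * N))"
    using Xmin X unfolding is_arg_min_linorder by fastforce
  moreover have "- L * eps < hard_fun L b (returned_point T \<Phi> \<Phi>out (hard_fun L b))"
    unfolding b_def by (rule returned_value[OF assms(1) eps big assms(4)])
  moreover have "L / (4 * N) < - L * eps - L * (eps * real T - 1 / (2 * N))"
  proof -
    have "- L * eps - L * (eps * real T - 1 / (2 * N)) = L * (1 / (2 * N) - eps * N)"
      by (simp add: N_def algebra_simps)
    also have "1 / (2 * N) - eps * N = 3 / (8 * N)"
      using N by (simp add: eps_def power2_eq_square field_simps)
    finally have "- L * eps - L * (eps * real T - 1 / (2 * N)) = L * (3 / (8 * N))" .
    moreover have "L * (1 / (4 * N)) < L * (3 / (8 * N))"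
      using N assms(1) by (intro mult_strict_left_mono) (simp_all add: field_simps)
    ultimately show ?thesis by simp
  qed
  ultimately have "L / (4 * (real T + 1)) < hard_fun L b (returned_point T \<Phi> \<Phi>out (hard_fun L b)) - hard_fun L b Xmin"
    unfolding N_def by linarith
  with F Xmin show ?thesis by blast
qed

end
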